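(* Let $\Gamma$ be a groupoid and $R$ a (object unital) $\Gamma$-graded ring. The following assertions are equivalent: (1) $R$ is a gr-semilocal ring. (2) $1_eR1_e$ is a gr-semilocal ring for every $e\in\Gamma_0$. (3) $R_e$ is a semilocal ring for every $e\in\Gamma_0$.
   Context: A groupoid $\Gamma$ is a small category in which every morphism is invertible. It is identified with its set of morphisms; $\Gamma_0$ is its set of objects, each object being identified with its identity morphism. For $\gamma\in\Gamma$, $d(\gamma)$ and $r(\gamma)$ denote domain and codomain, and $\delta\gamma$ is defined iff $d(\delta)=r(\gamma)$. Rings are associative, not necessarily unital. A $\Gamma$-graded ring is a ring $R=\bigoplus_{\gamma\in\Gamma}R_\gamma$ (additive subgroups) with $R_\gamma R_\delta\subseteq R_{\gamma\delta}$ if $\gamma\delta$ is defined and $R_\gamma R_\delta=0$ otherwise. All graded rings are assumed object unital: for each $e\in\Gamma_0$ the ring $R_e$ has an identity $1_e$ (possibly $0$), and $1_{r(\gamma)}a=a1_{d(\gamma)}=a$ for all $a\in R_\gamma$. For $e\in\Gamma_0$, $1_eR1_e=\bigoplus_{r(\gamma)=d(\gamma)=e}R_\gamma$ is a graded ring (graded by the group $e\Gamma e$ of morphisms from $e$ to $e$). A graded right ideal is a right ideal $U$ with $U=\bigoplus_\gamma(U\cap R_\gamma)$. It is gr-simple if it is nonzero and contains no graded right ideals other than $0$ and itself; it is gr-maximal if it is maximal among proper graded right ideals. $R$ is gr-semisimple if it is a sum of gr-simple graded right ideals (the zero ring is gr-semisimple). $\mathrm{rad}^{\mathrm{gr}}(R)$,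 the graded Jacobson radical, is the intersection of all gr-maximal graded right ideals of $R$ ($:=R$ if there are none); it is a graded two-sided ideal, so $R/\mathrm{rad}^{\mathrm{gr}}(R)$ is a $\Gamma$-graded ring. $R$ is gr-semilocal if $R/\mathrm{rad}^{\mathrm{gr}}(R)$ is a gr-semisimple ring. An (ungraded) unital ring is semilocal if its quotient by its Jacobson radical is semisimple; the zero ring counts as semilocal. *)

theory Defs
  imports "HOL-Algebra.Algebra"
begin

section \<open>Groupoids\<close>

text \<open>A groupoid is identified with its set of morphisms, and objects with their identity
  morphisms. \<open>Comp \<Gamma> \<delta> \<gamma>\<close> is the product \<open>\<delta>\<gamma>\<close>; it is meaningful only if
  \<open>Dom \<Gamma> \<delta> = Cod \<Gamma> \<gamma>\<close>.\<close>

record 'g groupoid_struct =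
  Mor :: "'g set"
  Obj :: "'g set"
  Dom :: "'g \<Rightarrow> 'g"
  Cod :: "'g \<Rightarrow> 'g"
  Comp :: "'g \<Rightarrow> 'g \<Rightarrow> 'g"

locale groupoid =
  fixes \<Gamma> :: "('g, 'm) groupoid_struct_scheme"
  assumes Obj_subset: "Obj \<Gamma> \<subseteq> Mor \<Gamma>"
    and Dom_in: "\<gamma> \<in> Mor \<Gamma> \<Longrightarrow> Dom \<Gamma> \<gamma> \<in> Obj \<Gamma>"
    and Cod_in: "\<gamma> \<in> Mor \<Gamma> \<Longrightarrow> Cod \<Gamma> \<gamma> \<in> Obj \<Gamma>"
    and Dom_Obj: "e \<in> Obj \<Gamma> \<Longrightarrow> Dom \<Gamma> e = e"
    and Cod_Obj: "e \<in> Obj \<Gamma> \<Longrightarrow> Cod \<Gamma> e = e"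
    and Comp_in: "\<lbrakk>\<delta> \<in> Mor \<Gamma>; \<gamma> \<in> Mor \<Gamma>; Dom \<Gamma> \<delta> = Cod \<Gamma> \<gamma>\<rbrakk> \<Longrightarrow> Comp \<Gamma> \<delta> \<gamma> \<in> Mor \<Gamma>"
    and Dom_Comp: "\<lbrakk>\<delta> \<in> Mor \<Gamma>; \<gamma> \<in> Mor \<Gamma>; Dom \<Gamma> \<delta> = Cod \<Gamma> \<gamma>\<rbrakk>
      \<Longrightarrow> Dom \<Gamma> (Comp \<Gamma> \<delta> \<gamma>) = Dom \<Gamma> \<gamma>"
    and Cod_Comp: "\<lbrakk>\<delta> \<in> Mor \<Gamma>; \<gamma> \<in> Mor \<Gamma>; Dom \<Gamma> \<delta> = Cod \<Gamma> \<gamma>\<rbrakk>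
      \<Longrightarrow> Cod \<Gamma> (Comp \<Gamma> \<delta> \<gamma>) = Cod \<Gamma> \<delta>"
    and Comp_assoc: "\<lbrakk>\<epsilon> \<in> Mor \<Gamma>; \<delta> \<in> Mor \<Gamma>; \<gamma> \<in> Mor \<Gamma>; Dom \<Gamma> \<epsilon> = Cod \<Gamma> \<delta>; Dom \<Gamma> \<delta> = Cod \<Gamma> \<gamma>\<rbrakk>
      \<Longrightarrow> Comp \<Gamma> (Comp \<Gamma> \<epsilon> \<delta>) \<gamma> = Comp \<Gamma> \<epsilon> (Comp \<Gamma> \<delta> \<gamma>)"
    and Comp_Dom: "\<gamma> \<in> Mor \<Gamma> \<Longrightarrow> Comp \<Gamma> \<gamma> (Dom \<Gamma> \<gamma>) = \<gamma>"
    and Cod_Comp_left: "\<gamma> \<in> Mor \<Gamma> \<Longrightarrow> Comp \<Gamma> (Cod \<Gamma> \<gamma>) \<gamma> = \<gamma>"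
    and inverse_ex: "\<gamma> \<in> Mor \<Gamma> \<Longrightarrow> \<exists>\<delta>\<in>Mor \<Gamma>. Dom \<Gamma> \<delta> = Cod \<Gamma> \<gamma> \<and> Cod \<Gamma> \<delta> = Dom \<Gamma> \<gamma> \<and>
      Comp \<Gamma> \<delta> \<gamma> = Dom \<Gamma> \<gamma> \<and> Comp \<Gamma> \<gamma> \<delta> = Cod \<Gamma> \<gamma>"

text \<open>The group \<open>e\<Gamma>e\<close> of morphisms from \<open>e\<close> to \<open>e\<close>, as a groupoid with one object.\<close>

definition vertex_group :: "('g, 'm) groupoid_struct_scheme \<Rightarrow> 'g \<Rightarrow> ('g, 'm) groupoid_struct_scheme"
  where "vertex_group \<Gamma> e =
    \<Gamma>\<lparr>Mor := {\<gamma> \<in> Mor \<Gamma>. Dom \<Gamma> \<gamma> = e \<and> Cod \<Gamma> \<gamma> = e}, Obj := {e}\<rparr>"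


section \<open>Rings without a global identity\<close>

text \<open>Non-unital rings use the record type of \<open>HOL-Algebra\<close>. The field \<open>one\<close> carries no meaning
  for them and is used by none of the notions below.\<close>

locale nonunital_ring = abelian_group R for R (structure) +
  assumes m_closed: "\<lbrakk>x \<in> carrier R; y \<in> carrier R\<rbrakk> \<Longrightarrow> x \<otimes> y \<in> carrier R"
    and m_assoc: "\<lbrakk>x \<in> carrier R; y \<in> carrier R; z \<in> carrier R\<rbrakk> \<Longrightarrow> (x \<otimes> y) \<otimes> z = x \<otimes> (y \<otimes> z)"
    and l_distr: "\<lbrakk>x \<in> carrier R; y \<in> carrier R; z \<in> carrier R\<rbrakk> \<Longrightarrow> (x \<oplus> y) \<otimes> z = x \<otimes> z \<oplus> y \<otimes> z"
    and r_distr: "\<lbrakk>x \<in> carrier R; y \<in> carrier R; z \<in> carrier R\<rbrakk> \<Longrightarrow> z \<otimes> (x \<oplus> y) = z \<otimes> x \<oplus> z \<otimes> y"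

definition right_ideal :: "'a set \<Rightarrow> ('a, 'm) ring_scheme \<Rightarrow> bool"
  where "right_ideal U R \<longleftrightarrow> additive_subgroup U R \<and> (\<forall>u\<in>U. \<forall>x\<in>carrier R. u \<otimes>\<^bsub>R\<^esub> x \<in> U)"

text \<open>All finite sums of elements taken from members of \<open>\<S>\<close>; for a set \<open>\<S>\<close> of additive subgroups
  this is their sum, with value \<open>{\<zero>}\<close> for empty \<open>\<S>\<close>.\<close>

definition sum_of_subgroups :: "('a, 'm) ring_scheme \<Rightarrow> 'a set set \<Rightarrow> 'a set"
  where "sum_of_subgroups R \<S> =
    {finsum R f F | f F. finite F \<and> F \<subseteq> \<S> \<and> (\<forall>U\<in>F. f U \<in> U)}"

definition direct_sum_families :: "('a, 'm) ring_scheme \<Rightarrow> 'i set \<Rightarrow> ('i \<Rightarrow> 'a set) \<Rightarrow> ('i \<Rightarrow> 'a) set"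
  where "direct_sum_families R I A =
    {f. (\<forall>i\<in>I. f i \<in> A i) \<and> (\<forall>i. i \<notin> I \<longrightarrow> f i = \<zero>\<^bsub>R\<^esub>) \<and> finite {i. f i \<noteq> \<zero>\<^bsub>R\<^esub>}}"

text \<open>\<open>U\<close> is the internal direct sum of the \<open>A i\<close>, \<open>i \<in> I\<close>: summation identifies the external
  direct sum with \<open>U\<close>.\<close>

definition internal_direct_sum ::
    "('a, 'm) ring_scheme \<Rightarrow> 'i set \<Rightarrow> ('i \<Rightarrow> 'a set) \<Rightarrow> 'a set \<Rightarrow> bool"
  where "internal_direct_sum R I A U \<longleftrightarrow>
    bij_betw (\<lambda>f. finsum R f {i. f i \<noteq> \<zero>\<^bsub>R\<^esub>}) (direct_sum_families R I A) U"

text \<open>The identity of the (sub)ring with carrier \<open>S\<close>, if it has one.\<close>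

definition unit_of :: "('a, 'm) ring_scheme \<Rightarrow> 'a set \<Rightarrow> 'a"
  where "unit_of R S = (THE u. u \<in> S \<and> (\<forall>a\<in>S. u \<otimes>\<^bsub>R\<^esub> a = a \<and> a \<otimes>\<^bsub>R\<^esub> u = a))"


section \<open>Semilocal unital rings\<close>

definition simple_right_ideal :: "'a set \<Rightarrow> ('a, 'm) ring_scheme \<Rightarrow> bool"
  where "simple_right_ideal U R \<longleftrightarrow> right_ideal U R \<and> U \<noteq> {\<zero>\<^bsub>R\<^esub>} \<and>
    (\<forall>V. right_ideal V R \<and> V \<subseteq> U \<longrightarrow> V = {\<zero>\<^bsub>R\<^esub>} \<or> V = U)"

definition maximal_right_ideal :: "'a set \<Rightarrow> ('a, 'm) ring_scheme \<Rightarrow> bool"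
  where "maximal_right_ideal M R \<longleftrightarrow> right_ideal M R \<and> M \<noteq> carrier R \<and>
    (\<forall>V. right_ideal V R \<and> M \<subseteq> V \<longrightarrow> V = M \<or> V = carrier R)"

text \<open>The radical is the whole ring if there is no maximal right ideal (the zero ring).\<close>

definition jacobson_radical :: "('a, 'm) ring_scheme \<Rightarrow> 'a set"
  where "jacobson_radical R = {x \<in> carrier R. \<forall>M. maximal_right_ideal M R \<longrightarrow> x \<in> M}"

definition semisimple_ring :: "('a, 'm) ring_scheme \<Rightarrow> bool"
  where "semisimple_ring R \<longleftrightarrow>
    (\<exists>\<S>. (\<forall>U\<in>\<S>. simple_right_ideal U R) \<and> carrier R = sum_of_subgroups R \<S>)"

definition semilocal_ring :: "('a, 'm) ring_scheme \<Rightarrow> bool"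
  where "semilocal_ring R \<longleftrightarrow> semisimple_ring (R Quot jacobson_radical R)"


section \<open>Graded rings\<close>

text \<open>\<open>A \<gamma>\<close> is the homogeneous component of degree \<open>\<gamma>\<close>; its values outside \<open>Mor \<Gamma>\<close> are irrelevant.\<close>

locale object_unital_graded_ring = groupoid \<Gamma> + nonunital_ring R
  for \<Gamma> :: "('g, 'm) groupoid_struct_scheme" and R :: "('a, 'n) ring_scheme" (structure) +
  fixes A :: "'g \<Rightarrow> 'a set"
  assumes component_subgroup: "\<gamma> \<in> Mor \<Gamma> \<Longrightarrow> additive_subgroup (A \<gamma>) R"
    and decomposition: "internal_direct_sum R (Mor \<Gamma>) A (carrier R)"
    and mult_composable: "\<lbrakk>\<gamma> \<in> Mor \<Gamma>; \<delta> \<in> Mor \<Gamma>; Dom \<Gamma> \<gamma> = Cod \<Gamma> \<delta>; a \<in> A \<gamma>; b \<in> A \<delta>\<rbrakk>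
      \<Longrightarrow> a \<otimes> b \<in> A (Comp \<Gamma> \<gamma> \<delta>)"
    and mult_not_composable: "\<lbrakk>\<gamma> \<in> Mor \<Gamma>; \<delta> \<in> Mor \<Gamma>; Dom \<Gamma> \<gamma> \<noteq> Cod \<Gamma> \<delta>; a \<in> A \<gamma>; b \<in> A \<delta>\<rbrakk>
      \<Longrightarrow> a \<otimes> b = \<zero>"
    and unit_ex: "e \<in> Obj \<Gamma> \<Longrightarrow> \<exists>u\<in>A e. \<forall>a\<in>A e. u \<otimes> a = a \<and> a \<otimes> u = a"
    and unit_left: "\<lbrakk>\<gamma> \<in> Mor \<Gamma>; a \<in> A \<gamma>\<rbrakk> \<Longrightarrow> unit_of R (A (Cod \<Gamma> \<gamma>)) \<otimes> a = a"
    and unit_right: "\<lbrakk>\<gamma> \<in> Mor \<Gamma>; a \<in> A \<gamma>\<rbrakk> \<Longrightarrow> a \<otimes> unit_of R (A (Dom \<Gamma> \<gamma>)) = a"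

definition graded_right_ideal ::
    "('g, 'm) groupoid_struct_scheme \<Rightarrow> ('a, 'n) ring_scheme \<Rightarrow> ('g \<Rightarrow> 'a set) \<Rightarrow> 'a set \<Rightarrow> bool"
  where "graded_right_ideal \<Gamma> R A U \<longleftrightarrow>
    right_ideal U R \<and> internal_direct_sum R (Mor \<Gamma>) (\<lambda>\<gamma>. U \<inter> A \<gamma>) U"

definition gr_simple ::
    "('g, 'm) groupoid_struct_scheme \<Rightarrow> ('a, 'n) ring_scheme \<Rightarrow> ('g \<Rightarrow> 'a set) \<Rightarrow> 'a set \<Rightarrow> bool"
  where "gr_simple \<Gamma> R A U \<longleftrightarrow> graded_right_ideal \<Gamma> R A U \<and> U \<noteq> {\<zero>\<^bsub>R\<^esub>} \<and>
    (\<forall>V. graded_right_ideal \<Gamma> R A V \<and> V \<subseteq> U \<longrightarrow> V = {\<zero>\<^bsub>R\<^esub>} \<or> V = U)"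

definition gr_maximal ::
    "('g, 'm) groupoid_struct_scheme \<Rightarrow> ('a, 'n) ring_scheme \<Rightarrow> ('g \<Rightarrow> 'a set) \<Rightarrow> 'a set \<Rightarrow> bool"
  where "gr_maximal \<Gamma> R A M \<longleftrightarrow> graded_right_ideal \<Gamma> R A M \<and> M \<noteq> carrier R \<and>
    (\<forall>V. graded_right_ideal \<Gamma> R A V \<and> M \<subseteq> V \<longrightarrow> V = M \<or> V = carrier R)"

definition gr_radical ::
    "('g, 'm) groupoid_struct_scheme \<Rightarrow> ('a, 'n) ring_scheme \<Rightarrow> ('g \<Rightarrow> 'a set) \<Rightarrow> 'a set"
  where "gr_radical \<Gamma> R A = {x \<in> carrier R. \<forall>M. gr_maximal \<Gamma> R A M \<longrightarrow> x \<in> M}"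

definition gr_semisimple ::
    "('g, 'm) groupoid_struct_scheme \<Rightarrow> ('a, 'n) ring_scheme \<Rightarrow> ('g \<Rightarrow> 'a set) \<Rightarrow> bool"
  where "gr_semisimple \<Gamma> R A \<longleftrightarrow>
    (\<exists>\<S>. (\<forall>U\<in>\<S>. gr_simple \<Gamma> R A U) \<and> carrier R = sum_of_subgroups R \<S>)"

text \<open>The component of degree \<open>\<gamma>\<close> of \<open>R/I\<close> is the image \<open>(A \<gamma> + I)/I\<close> of \<open>A \<gamma>\<close>.\<close>

definition quotient_grading :: "('a, 'n) ring_scheme \<Rightarrow> 'a set \<Rightarrow> ('g \<Rightarrow> 'a set) \<Rightarrow> 'g \<Rightarrow> 'a set set"
  where "quotient_grading R I A \<gamma> = (\<lambda>a. I +>\<^bsub>R\<^esub> a) ` A \<gamma>"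

definition gr_semilocal ::
    "('g, 'm) groupoid_struct_scheme \<Rightarrow> ('a, 'n) ring_scheme \<Rightarrow> ('g \<Rightarrow> 'a set) \<Rightarrow> bool"
  where "gr_semilocal \<Gamma> R A \<longleftrightarrow>
    (let J = gr_radical \<Gamma> R A in gr_semisimple \<Gamma> (R Quot J) (quotient_grading R J A))"

text \<open>The unital ring \<open>R\<^sub>e\<close> and the corner ring \<open>1\<^sub>e R 1\<^sub>e\<close>. The components of the latter are those
  of \<open>R\<close> in the degrees of \<open>vertex_group \<Gamma> e\<close>.\<close>

definition component_ring :: "('a, 'n) ring_scheme \<Rightarrow> ('g \<Rightarrow> 'a set) \<Rightarrow> 'g \<Rightarrow> ('a, 'n) ring_scheme"
  where "component_ring R A e = R\<lparr>carrier := A e, one := unit_of R (A e)\<rparr>"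

definition corner_ring :: "('a, 'n) ring_scheme \<Rightarrow> ('g \<Rightarrow> 'a set) \<Rightarrow> 'g \<Rightarrow> ('a, 'n) ring_scheme"
  where "corner_ring R A e =
    R\<lparr>carrier := {unit_of R (A e) \<otimes>\<^bsub>R\<^esub> x \<otimes>\<^bsub>R\<^esub> unit_of R (A e) | x. x \<in> carrier R},
      one := unit_of R (A e)\<rparr>"

end

theory Submission
  imports Defs
begin

text \<open>Everything is read off from inclusions between right ideals. Let \<open>J\<close> be the graded radical of \<open>R\<close>.
  Right ideals of a quotient by \<open>J\<close> are right ideals containing \<open>J\<close>, and the simple ones among
  them are the covers of \<open>J\<close>; hence \<open>R\<close> is gr-semilocal iff no proper graded right ideal
  contains \<open>J\<close> and all covers of \<open>J\<close> (\<open>gr_semilocal_iff\<close>). An ungraded ring is a ring graded by a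
  trivial groupoid, so the same criterion describes the semilocality of the rings \<open>R\<^sub>e\<close>.

  The link between \<open>R\<close> and \<open>R\<^sub>e\<close> is an adjunction. For a right ideal \<open>N\<close> of \<open>R\<^sub>e\<close> let
  \<open>extension e N\<close> consist of the \<open>x\<close> such that the component of degree \<open>e\<close> of \<open>xy\<close> lies in \<open>N\<close> for all
  \<open>y\<close>. It is the largest graded right ideal whose trace on \<open>R\<^sub>e\<close> lies in \<open>N\<close>
  (\<open>subset_extension_iff\<close>); its trace on \<open>R\<^sub>e\<close> is exactly \<open>N\<close>, and it contains \<open>R\<^sub>f\<close> for every
  other object \<open>f\<close>. Since a right ideal is everything as soon as it contains all local units, this
  makes \<open>N \<mapsto> extension e N\<close>, for varying \<open>e\<close>, a bijection from the maximal right ideals of the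
  \<open>R\<^sub>e\<close> to the gr-maximal right ideals of \<open>R\<close>
  (\<open>extension_gr_maximal\<close>, \<open>gr_maximal_is_extension\<close>). Therefore \<open>J\<close> traces out the Jacobson radical on each
  \<open>R\<^sub>e\<close>, and a graded right ideal lies in \<open>J\<close> as soon as all its traces do. With these two facts
  the covers of \<open>J\<close> in \<open>R\<close> and the covers of its traces in the \<open>R\<^sub>e\<close> determine each other, which
  shows that \<open>R\<close> is gr-semilocal iff all \<open>R\<^sub>e\<close> are semilocal
  (\<open>gr_semilocal_iff_components_semilocal\<close>).

  The corner ring \<open>1\<^sub>eR1\<^sub>e\<close> is graded over a groupoid with the single object \<open>e\<close>, and its component of
  degree \<open>e\<close> is again \<open>R\<^sub>e\<close>. So the same statement, applied to the corner ring, says that it is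
  gr-semilocal iff \<open>R\<^sub>e\<close> is semilocal.\<close>

section \<open>Direct sums and homogeneous components\<close>

text \<open>Apart from the inclusion in the carrier, the right-hand side does not mention the carrier,
  which allows subgroups of a ring and of its subrings to be compared.\<close>

lemma additive_subgroup_iff:
  assumes "abelian_group G"
  shows "additive_subgroup H G \<longleftrightarrow> H \<subseteq> carrier G \<and> \<zero>\<^bsub>G\<^esub> \<in> H \<and>
    (\<forall>x\<in>H. \<forall>y\<in>H. x \<oplus>\<^bsub>G\<^esub> y \<in> H) \<and> (\<forall>x\<in>H. \<exists>y\<in>H. y \<oplus>\<^bsub>G\<^esub> x = \<zero>\<^bsub>G\<^esub>)"
proof -
  interpret abelian_group G by fact
  show ?thesis
  proof
    assume "additive_subgroup H G"
    then interpret additive_subgroup H G .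
    show "H \<subseteq> carrier G \<and> \<zero>\<^bsub>G\<^esub> \<in> H \<and>
      (\<forall>x\<in>H. \<forall>y\<in>H. x \<oplus>\<^bsub>G\<^esub> y \<in> H) \<and> (\<forall>x\<in>H. \<exists>y\<in>H. y \<oplus>\<^bsub>G\<^esub> x = \<zero>\<^bsub>G\<^esub>)"
      using a_subset a_inv_closed l_neg by auto
  next
    assume H: "H \<subseteq> carrier G \<and> \<zero>\<^bsub>G\<^esub> \<in> H \<and>
      (\<forall>x\<in>H. \<forall>y\<in>H. x \<oplus>\<^bsub>G\<^esub> y \<in> H) \<and> (\<forall>x\<in>H. \<exists>y\<in>H. y \<oplus>\<^bsub>G\<^esub> x = \<zero>\<^bsub>G\<^esub>)"
    have "\<ominus>\<^bsub>G\<^esub> x \<in> H" if x: "x \<in> H" for x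
    proof -
      obtain y where y: "y \<in> H" "y \<oplus>\<^bsub>G\<^esub> x = \<zero>\<^bsub>G\<^esub>" using H x by blast
      then have "\<ominus>\<^bsub>G\<^esub> x = y" using H x minus_equality by blast
      then show ?thesis using y by simp
    qed
    with H show "additive_subgroup H G"
      by (intro additive_subgroup.intro add.subgroupI) (auto simp: a_inv_def)
  qed
qed

lemma additive_subgroup_elim:
  assumes "additive_subgroup H G" "abelian_group G"
  shows "x \<in> H \<Longrightarrow> x \<in> carrier G" "\<zero>\<^bsub>G\<^esub> \<in> H"
    "\<lbrakk>x \<in> H; y \<in> H\<rbrakk> \<Longrightarrow> x \<oplus>\<^bsub>G\<^esub> y \<in> H" "x \<in> H \<Longrightarrow> \<ominus>\<^bsub>G\<^esub> x \<in> H"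
    "\<lbrakk>x \<in> H; y \<in> H\<rbrakk> \<Longrightarrow> x \<ominus>\<^bsub>G\<^esub> y \<in> H"
  using additive_subgroup.a_subset[OF assms(1)] additive_subgroup.zero_closed[OF assms(1)]
    additive_subgroup.a_closed[OF assms(1)] additive_subgroup.a_inv_closed[OF assms(1)]
  by (auto simp: a_minus_def)

context abelian_group
begin

lemma finsum_in_additive_subgroup:
  assumes "additive_subgroup U G" "finite F" "\<And>i. i \<in> F \<Longrightarrow> f i \<in> U"
  shows "finsum G f F \<in> U"
  using assms(2,3)
proof (induction F)
  case (insert i F)
  have "finsum G f (insert i F) = f i \<oplus> finsum G f F"
    using insert additive_subgroup_elim(1)[OF assms(1) abelian_group_axioms]
    by (intro finsum_insert) auto
  then show ?case using insert additive_subgroup_elim(3)[OF assms(1) abelian_group_axioms] by auto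
qed (simp add: additive_subgroup_elim(2)[OF assms(1) abelian_group_axioms])

lemma additive_map_zero_minus:
  assumes U: "additive_subgroup U G"
    and p: "\<And>x. x \<in> U \<Longrightarrow> p x \<in> carrier G"
    and add: "\<And>x y. \<lbrakk>x \<in> U; y \<in> U\<rbrakk> \<Longrightarrow> p (x \<oplus> y) = p x \<oplus> p y"
  shows "p \<zero> = \<zero>" and "x \<in> U \<Longrightarrow> p (\<ominus> x) = \<ominus> p x"
proof -
  note U' = additive_subgroup_elim[OF U abelian_group_axioms]
  have "p \<zero> \<oplus> p \<zero> = p \<zero> \<oplus> \<zero>" using add[OF U'(2) U'(2)] p[OF U'(2)] by simp
  then show z: "p \<zero> = \<zero>" using p[OF U'(2)] by (metis add.l_cancel zero_closed)
  assume x: "x \<in> U"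
  have "p (\<ominus> x) \<oplus> p x = \<zero>" using add[OF U'(4)[OF x] x] z U'(1)[OF x] by (simp add: l_neg)
  then show "p (\<ominus> x) = \<ominus> p x" using p x U'(4) by (metis minus_equality)
qed

lemma additive_map_finsum:
  assumes U: "additive_subgroup U G"
    and p: "\<And>x. x \<in> U \<Longrightarrow> p x \<in> carrier G"
    and add: "\<And>x y. \<lbrakk>x \<in> U; y \<in> U\<rbrakk> \<Longrightarrow> p (x \<oplus> y) = p x \<oplus> p y"
    and F: "finite F" "\<And>i. i \<in> F \<Longrightarrow> f i \<in> U"
  shows "p (finsum G f F) = finsum G (\<lambda>i. p (f i)) F"
  using F
proof (induction F)
  case empty
  show ?case using additive_map_zero_minus(1)[OF U p add] by simp
next
  case (insert i F)
  have c: "f j \<in> carrier G" if "j \<in> insert i F" for j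
    using insert.prems that additive_subgroup_elim(1)[OF U abelian_group_axioms] by blast
  have "finsum G f (insert i F) = f i \<oplus> finsum G f F"
    using insert.hyps c by (intro finsum_insert) auto
  moreover have "finsum G (\<lambda>i. p (f i)) (insert i F) = p (f i) \<oplus> finsum G (\<lambda>i. p (f i)) F"
    using insert p by (intro finsum_insert) auto
  ultimately show ?case
    using insert add[of "f i" "finsum G f F"] finsum_in_additive_subgroup[OF U insert.hyps(1), of f] by auto
qed

text \<open>A direct sum is recognised by its projections. The only point that needs an argument is
  surjectivity: \<open>x\<close> minus the sum of its projections has all projections zero. In this form the
  criterion serves graded right ideals, quotients, subrings and trivial gradings alike.\<close>

lemma internal_direct_sumI:
  assumes U: "additive_subgroup U G"
    and B: "\<And>i. i \<in> I \<Longrightarrow> B i \<subseteq> U"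
    and p_in: "\<And>i x. \<lbrakk>i \<in> I; x \<in> U\<rbrakk> \<Longrightarrow> p i x \<in> B i"
    and p_add: "\<And>i x y. \<lbrakk>i \<in> I; x \<in> U; y \<in> U\<rbrakk> \<Longrightarrow> p i (x \<oplus> y) = p i x \<oplus> p i y"
    and p_same: "\<And>i b. \<lbrakk>i \<in> I; b \<in> B i\<rbrakk> \<Longrightarrow> p i b = b"
    and p_other: "\<And>i j b. \<lbrakk>i \<in> I; j \<in> I; i \<noteq> j; b \<in> B i\<rbrakk> \<Longrightarrow> p j b = \<zero>"
    and p_finite: "\<And>x. x \<in> U \<Longrightarrow> finite {i \<in> I. p i x \<noteq> \<zero>}"
    and p_zero: "\<And>x. \<lbrakk>x \<in> U; \<And>i. i \<in> I \<Longrightarrow> p i x = \<zero>\<rbrakk> \<Longrightarrow> x = \<zero>"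
  shows "internal_direct_sum G I B U"
proof -
  note U' = additive_subgroup_elim[OF U abelian_group_axioms]
  let ?D = "direct_sum_families G I B"
  let ?s = "\<lambda>f. finsum G f {i. f i \<noteq> \<zero>}"
  have D_in: "f i \<in> B i" "f i \<in> U" if "f \<in> ?D" "f i \<noteq> \<zero>" for f i
    using that B unfolding direct_sum_families_def by auto
  have supp: "finite {i. f i \<noteq> \<zero>}" "{i. f i \<noteq> \<zero>} \<subseteq> I" if "f \<in> ?D" for f
    using that unfolding direct_sum_families_def by auto
  have s_in: "?s f \<in> U" if "f \<in> ?D" for f
    using finsum_in_additive_subgroup[OF U supp(1)[OF that]] D_in(2)[OF that] by blast
  have p_carr: "p j x \<in> carrier G" if "j \<in> I" "x \<in> U" for j x
    using p_in[OF that] B[OF that(1)] U'(1) by blast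
  have ps: "p j (?s f) = f j" if f: "f \<in> ?D" and j: "j \<in> I" for f j
  proof -
    have "p j (?s f) = finsum G (\<lambda>i. p j (f i)) {i. f i \<noteq> \<zero>}"
      using additive_map_finsum[OF U p_carr[OF j] p_add[OF j] supp(1)[OF f]] D_in(2)[OF f] by simp
    also have "\<dots> = finsum G (\<lambda>i. if j = i then f i else \<zero>) {i. f i \<noteq> \<zero>}"
      using D_in[OF f] supp(2)[OF f] p_same p_other[OF _ j] U'(1)
      by (intro finsum_cong') (auto simp: subset_iff)
    also have "\<dots> = f j"
    proof (cases "f j = \<zero>")
      case True
      then have "finsum G (\<lambda>i. if j = i then f i else \<zero>) {i. f i \<noteq> \<zero>} = finsum G (\<lambda>i. \<zero>) {i. f i \<noteq> \<zero>}"
        by (intro finsum_cong') auto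
      then show ?thesis using True by simp
    next
      case False
      then show ?thesis
        using finsum_singleton[of j "{i. f i \<noteq> \<zero>}" f] supp(1)[OF f] D_in(2)[OF f] U'(1) by auto
    qed
    finally show ?thesis .
  qed
  have "inj_on ?s ?D"
  proof (rule inj_onI)
    fix f g assume fg: "f \<in> ?D" "g \<in> ?D" "?s f = ?s g"
    show "f = g"
    proof
      fix i
      show "f i = g i"
      proof (cases "i \<in> I")
        case True
        then show ?thesis using ps[OF fg(1) True] ps[OF fg(2) True] fg(3) by simp
      next
        case False
        then show ?thesis using fg(1,2) unfolding direct_sum_families_def by auto
      qed
    qed
  qed
  moreover have "?s ` ?D = U"
  proof
    show "?s ` ?D \<subseteq> U" using s_in by blast
    show "U \<subseteq> ?s ` ?D"
    proof
      fix x assume x: "x \<in> U"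
      define f where "f = (\<lambda>i. if i \<in> I then p i x else \<zero>)"
      have "{i. f i \<noteq> \<zero>} = {i \<in> I. p i x \<noteq> \<zero>}" by (auto simp: f_def)
      then have f: "f \<in> ?D"
        using p_in[OF _ x] p_finite[OF x] unfolding direct_sum_families_def by (auto simp: f_def)
      have "x \<ominus> ?s f = \<zero>"
      proof (rule p_zero[OF U'(5)[OF x s_in[OF f]]])
        fix i assume i: "i \<in> I"
        have "p i (x \<ominus> ?s f) = p i x \<oplus> p i (\<ominus> ?s f)"
          unfolding a_minus_def using p_add[OF i x U'(4)[OF s_in[OF f]]] .
        also have "p i (\<ominus> ?s f) = \<ominus> p i (?s f)"
          using additive_map_zero_minus(2)[OF U p_carr[OF i] p_add[OF i] s_in[OF f]] .
        also have "p i (?s f) = p i x" using ps[OF f i] i by (simp add: f_def)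
        finally show "p i (x \<ominus> ?s f) = \<zero>" using p_carr[OF i x] by (simp add: r_neg)
      qed
      then have "x = ?s f" using U'(1)[OF x] U'(1)[OF s_in[OF f]] by (metis a_minus_def add.inv_solve_right l_zero zero_closed)
      then show "x \<in> ?s ` ?D" using f by blast
    qed
  qed
  ultimately show ?thesis unfolding internal_direct_sum_def bij_betw_def by blast
qed

end

text \<open>The inverse of the summation bijection of an internal direct sum over \<open>I\<close>; so the component is
  zero in degrees outside \<open>I\<close>.\<close>

definition homogeneous_component ::
    "('a, 'n) ring_scheme \<Rightarrow> 'g set \<Rightarrow> ('g \<Rightarrow> 'a set) \<Rightarrow> 'a \<Rightarrow> 'g \<Rightarrow> 'a"
  where "homogeneous_component R I A x = (THE f. f \<in> direct_sum_families R I A \<and>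
    finsum R f {i. f i \<noteq> \<zero>\<^bsub>R\<^esub>} = x)"

text \<open>The additive part of a grading: it passes to quotients by graded ideals, and it suffices to
  describe graded right ideals.\<close>

locale decomposed_ring = nonunital_ring R
  for \<Gamma> :: "('g, 'm) groupoid_struct_scheme" and R :: "('a, 'n) ring_scheme" (structure) +
  fixes A :: "'g \<Rightarrow> 'a set"
  assumes component_subgroup: "\<gamma> \<in> Mor \<Gamma> \<Longrightarrow> additive_subgroup (A \<gamma>) R"
    and decomposition: "internal_direct_sum R (Mor \<Gamma>) A (carrier R)"
begin

abbreviation comp :: "'a \<Rightarrow> 'g \<Rightarrow> 'a"
  where "comp \<equiv> homogeneous_component R (Mor \<Gamma>) A"

lemmas component = additive_subgroup_elim[OF component_subgroup abelian_group_axioms]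

abbreviation families :: "('g \<Rightarrow> 'a) set"
  where "families \<equiv> direct_sum_families R (Mor \<Gamma>) A"

lemma comp_unique:
  assumes "x \<in> carrier R"
  shows "\<exists>!f. f \<in> families \<and> finsum R f {i. f i \<noteq> \<zero>} = x"
proof -
  note b = decomposition[unfolded internal_direct_sum_def]
  obtain f where f: "f \<in> families" "finsum R f {i. f i \<noteq> \<zero>} = x"
    using assms unfolding bij_betw_imp_surj_on[OF b, symmetric] by blast
  show ?thesis
  proof (rule ex1I[of _ f])
    fix g assume "g \<in> families \<and> finsum R g {i. g i \<noteq> \<zero>} = x"
    then show "g = f" using inj_onD[OF bij_betw_imp_inj_on[OF b], of g f] f by simp
  qed (use f in simp)
qed

lemma comp_family:
  assumes "x \<in> carrier R"
  shows "comp x \<in> families" and "finsum R (comp x) {i. comp x i \<noteq> \<zero>} = x"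
  using theI'[OF comp_unique[OF assms]] unfolding homogeneous_component_def by auto

lemma comp_eqI:
  assumes "f \<in> families" "finsum R f {i. f i \<noteq> \<zero>} = x" "x \<in> carrier R"
  shows "comp x = f"
  using comp_unique[OF assms(3)] comp_family[OF assms(3)] assms(1,2) by blast

lemma comp_in: "\<lbrakk>x \<in> carrier R; \<gamma> \<in> Mor \<Gamma>\<rbrakk> \<Longrightarrow> comp x \<gamma> \<in> A \<gamma>"
  and comp_outside: "\<lbrakk>x \<in> carrier R; \<gamma> \<notin> Mor \<Gamma>\<rbrakk> \<Longrightarrow> comp x \<gamma> = \<zero>"
  and comp_finite: "x \<in> carrier R \<Longrightarrow> finite {\<gamma>. comp x \<gamma> \<noteq> \<zero>}"
  using comp_family(1)[of x] unfolding direct_sum_families_def by auto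

lemma comp_closed: "x \<in> carrier R \<Longrightarrow> comp x \<gamma> \<in> carrier R"
  using comp_in[of x \<gamma>] comp_outside[of x \<gamma>] component(1)[of \<gamma>] by (cases "\<gamma> \<in> Mor \<Gamma>") auto

lemma finsum_supset_support:
  assumes "finite F" "{i. f i \<noteq> \<zero>} \<subseteq> F" "\<And>i. f i \<in> carrier R"
  shows "finsum R f F = finsum R f {i. f i \<noteq> \<zero>}"
  using assms by (intro add.finprod_mono_neutral_cong_right) auto

lemma comp_add:
  assumes x: "x \<in> carrier R" and y: "y \<in> carrier R"
  shows "comp (x \<oplus> y) \<gamma> = comp x \<gamma> \<oplus> comp y \<gamma>"
proof -
  let ?f = "\<lambda>\<gamma>. comp x \<gamma> \<oplus> comp y \<gamma>"
  let ?F = "{\<gamma>. comp x \<gamma> \<noteq> \<zero>} \<union> {\<gamma>. comp y \<gamma> \<noteq> \<zero>}"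
  have F: "finite ?F" using comp_finite x y by simp
  have sub: "{\<gamma>. ?f \<gamma> \<noteq> \<zero>} \<subseteq> ?F" by auto
  have "?f \<in> families"
    unfolding direct_sum_families_def
    using comp_in x y component(3) comp_outside finite_subset[OF sub F] by auto
  moreover have "finsum R ?f {\<gamma>. ?f \<gamma> \<noteq> \<zero>} = x \<oplus> y"
  proof -
    have "finsum R ?f {\<gamma>. ?f \<gamma> \<noteq> \<zero>} = finsum R ?f ?F"
      using finsum_supset_support[OF F sub] comp_closed x y by simp
    also have "\<dots> = finsum R (comp x) ?F \<oplus> finsum R (comp y) ?F"
      using comp_closed x y by (intro finsum_addf) auto
    also have "\<dots> = x \<oplus> y"
      using finsum_supset_support[OF F, of "comp x"] finsum_supset_support[OF F, of "comp y"]
        comp_closed x y comp_family(2) by simp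
    finally show ?thesis .
  qed
  ultimately have "comp (x \<oplus> y) = ?f" by (rule comp_eqI) (use x y in simp)
  then show ?thesis by (rule fun_cong)
qed

lemma carrier_subgroup: "additive_subgroup (carrier R) R"
  by (simp add: additive_subgroup_def add.subgroup_self)

lemma comp_zero: "comp \<zero> \<gamma> = \<zero>"
  and comp_minus: "x \<in> carrier R \<Longrightarrow> comp (\<ominus> x) \<gamma> = \<ominus> comp x \<gamma>"
  using additive_map_zero_minus[OF carrier_subgroup, of "\<lambda>x. comp x \<gamma>"] comp_closed comp_add by auto

lemma comp_homogeneous:
  assumes a: "a \<in> A \<gamma>" and \<gamma>: "\<gamma> \<in> Mor \<Gamma>"
  shows "comp a \<delta> = (if \<delta> = \<gamma> then a else \<zero>)"
proof -
  let ?f = "\<lambda>\<delta>. if \<delta> = \<gamma> then a else \<zero>"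
  have ac: "a \<in> carrier R" using component(1)[OF \<gamma> a] .
  have sub: "{\<delta>. ?f \<delta> \<noteq> \<zero>} \<subseteq> {\<gamma>}" by auto
  have "finsum R ?f {\<delta>. ?f \<delta> \<noteq> \<zero>} = finsum R ?f {\<gamma>}"
    using finsum_supset_support[OF _ sub] ac by simp
  also have "\<dots> = a" using finsum_singleton[of \<gamma> "{\<gamma>}" "\<lambda>_. a"] ac
    by (simp add: finsum_insert Pi_def)
  finally have s: "finsum R ?f {\<delta>. ?f \<delta> \<noteq> \<zero>} = a" .
  have "?f \<in> families" using a \<gamma> component(2) finite_subset[OF sub] unfolding direct_sum_families_def by auto
  then show ?thesis using comp_eqI[OF _ s ac] by simp
qed

text \<open>An element is the finite sum of its components, so whatever is closed under addition and
  contains them contains the element. This replaces explicit finite sums in what follows.\<close>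

lemma in_if_components_in:
  assumes x: "x \<in> carrier R"
    and zero: "\<zero> \<in> T"
    and add: "\<And>y z. \<lbrakk>y \<in> carrier R; z \<in> carrier R; y \<in> T; z \<in> T\<rbrakk> \<Longrightarrow> y \<oplus> z \<in> T"
    and comps: "\<And>\<gamma>. \<gamma> \<in> Mor \<Gamma> \<Longrightarrow> comp x \<gamma> \<in> T"
  shows "x \<in> T"
proof -
  have "finsum R (comp x) F \<in> T" if "finite F" "F \<subseteq> Mor \<Gamma>" for F
    using that
  proof (induction F)
    case (insert \<gamma> F)
    have "finsum R (comp x) (insert \<gamma> F) = comp x \<gamma> \<oplus> finsum R (comp x) F"
      using insert comp_closed[OF x] by (intro finsum_insert) auto
    then show ?case using insert add[of "comp x \<gamma>" "finsum R (comp x) F"] comps comp_closed[OF x] by auto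
  qed (simp add: zero)
  then have "finsum R (comp x) {\<gamma>. comp x \<gamma> \<noteq> \<zero>} \<in> T"
    using comp_finite[OF x] comp_outside[OF x] by blast
  then show ?thesis using comp_family(2)[OF x] by simp
qed

lemma in_subgroup_if_components_in:
  assumes "additive_subgroup T R" "x \<in> carrier R" "\<And>\<gamma>. \<gamma> \<in> Mor \<Gamma> \<Longrightarrow> comp x \<gamma> \<in> T"
  shows "x \<in> T"
  using in_if_components_in[OF assms(2) _ _ assms(3)]
    additive_subgroup_elim[OF assms(1) abelian_group_axioms] by blast

lemma homogeneous_induct [consumes 1, case_names zero homogeneous add]:
  assumes "x \<in> carrier R" "P \<zero>" "\<And>\<gamma> a. \<lbrakk>\<gamma> \<in> Mor \<Gamma>; a \<in> A \<gamma>\<rbrakk> \<Longrightarrow> P a"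
    "\<And>y z. \<lbrakk>y \<in> carrier R; z \<in> carrier R; P y; P z\<rbrakk> \<Longrightarrow> P (y \<oplus> z)"
  shows "P x"
  using in_if_components_in[of x "Collect P"] comp_in assms by auto

lemma zero_in_subgroup: "additive_subgroup {\<zero>} R"
  using abelian_group_axioms by (simp add: additive_subgroup_iff)

lemma zero_if_components_zero:
  assumes "x \<in> carrier R" "\<And>\<gamma>. \<gamma> \<in> Mor \<Gamma> \<Longrightarrow> comp x \<gamma> = \<zero>"
  shows "x = \<zero>"
  using in_subgroup_if_components_in[OF zero_in_subgroup assms(1)] assms(2) by simp

lemma graded_subgroup_iff:
  assumes U: "additive_subgroup U R"
  shows "internal_direct_sum R (Mor \<Gamma>) (\<lambda>\<gamma>. U \<inter> A \<gamma>) U \<longleftrightarrow> (\<forall>x\<in>U. \<forall>\<gamma>\<in>Mor \<Gamma>. comp x \<gamma> \<in> U)"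
proof
  note U' = additive_subgroup_elim[OF U abelian_group_axioms]
  assume S: "internal_direct_sum R (Mor \<Gamma>) (\<lambda>\<gamma>. U \<inter> A \<gamma>) U"
  show "\<forall>x\<in>U. \<forall>\<gamma>\<in>Mor \<Gamma>. comp x \<gamma> \<in> U"
  proof (intro ballI)
    fix x \<gamma> assume x: "x \<in> U" and \<gamma>: "\<gamma> \<in> Mor \<Gamma>"
    obtain f where f: "f \<in> direct_sum_families R (Mor \<Gamma>) (\<lambda>\<gamma>. U \<inter> A \<gamma>)"
      "finsum R f {i. f i \<noteq> \<zero>} = x"
      using bij_betw_imp_surj_on[OF S[unfolded internal_direct_sum_def]] x by (metis (no_types, lifting) imageE)
    then have "comp x = f"
      using U'(1)[OF x] by (intro comp_eqI) (auto simp: direct_sum_families_def)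
    then show "comp x \<gamma> \<in> U" using f(1) \<gamma> by (auto simp: direct_sum_families_def)
  qed
next
  note U' = additive_subgroup_elim[OF U abelian_group_axioms]
  assume C: "\<forall>x\<in>U. \<forall>\<gamma>\<in>Mor \<Gamma>. comp x \<gamma> \<in> U"
  show "internal_direct_sum R (Mor \<Gamma>) (\<lambda>\<gamma>. U \<inter> A \<gamma>) U"
  proof (rule internal_direct_sumI[where p = "\<lambda>\<gamma> x. comp x \<gamma>", OF U])
    fix x assume x: "x \<in> U"
    show "finite {i \<in> Mor \<Gamma>. comp x i \<noteq> \<zero>}"
      by (rule finite_subset[OF _ comp_finite[OF U'(1)[OF x]]]) auto
    show "\<And>\<gamma>. \<gamma> \<in> Mor \<Gamma> \<Longrightarrow> comp x \<gamma> \<in> U \<inter> A \<gamma>" using C x comp_in[OF U'(1)[OF x]] by blast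
    show "x = \<zero>" if "\<And>\<gamma>. \<gamma> \<in> Mor \<Gamma> \<Longrightarrow> comp x \<gamma> = \<zero>"
      using zero_if_components_zero[OF U'(1)[OF x] that] .
    show "comp (x \<oplus> y) \<gamma> = comp x \<gamma> \<oplus> comp y \<gamma>" if "y \<in> U" for y \<gamma>
      using comp_add[OF U'(1)[OF x] U'(1)[OF that]] .
  next
    fix \<gamma> b assume b: "\<gamma> \<in> Mor \<Gamma>" "b \<in> U \<inter> A \<gamma>"
    then show "comp b \<gamma> = b" using comp_homogeneous[of b \<gamma>] by simp
    show "comp b \<delta> = \<zero>" if "\<gamma> \<noteq> \<delta>" for \<delta> using b comp_homogeneous[of b \<gamma>] that by simp
  qed simp
qed

lemma graded_right_ideal_iff:
  "graded_right_ideal \<Gamma> R A U \<longleftrightarrow> right_ideal U R \<and> (\<forall>x\<in>U. \<forall>\<gamma>\<in>Mor \<Gamma>. comp x \<gamma> \<in> U)"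
  unfolding graded_right_ideal_def right_ideal_def using graded_subgroup_iff by blast

end

section \<open>Covers and gr-semisimplicity\<close>

lemma (in abelian_group)
  assumes S: "\<And>U. U \<in> \<S> \<Longrightarrow> additive_subgroup U G"
  shows sum_of_subgroups_subgroup: "additive_subgroup (sum_of_subgroups G \<S>) G"
    and sum_of_subgroups_upper: "U \<in> \<S> \<Longrightarrow> U \<subseteq> sum_of_subgroups G \<S>"
    and sum_of_subgroups_least:
      "\<lbrakk>additive_subgroup W G; \<And>U. U \<in> \<S> \<Longrightarrow> U \<subseteq> W\<rbrakk> \<Longrightarrow> sum_of_subgroups G \<S> \<subseteq> W"
proof -
  note S' = additive_subgroup_elim[OF S abelian_group_axioms]
  show least: "sum_of_subgroups G \<S> \<subseteq> W"
    if "additive_subgroup W G" "\<And>U. U \<in> \<S> \<Longrightarrow> U \<subseteq> W" for W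
    unfolding sum_of_subgroups_def
  proof clarify
    fix f F assume "finite F" "F \<subseteq> \<S>" "\<forall>U\<in>F. f U \<in> U"
    then show "finsum G f F \<in> W" using that(2) by (intro finsum_in_additive_subgroup[OF that(1)]) auto
  qed
  have I: "finsum G f F \<in> sum_of_subgroups G \<S>"
    if "finite F" "F \<subseteq> \<S>" "\<And>U. U \<in> F \<Longrightarrow> f U \<in> U" for f F
    unfolding sum_of_subgroups_def using that by blast
  have extend: "finsum G f F = finsum G (\<lambda>U. if U \<in> F then f U else \<zero>) F'"
    if "finite F'" "F \<subseteq> F'" "F \<subseteq> \<S>" "\<And>U. U \<in> F \<Longrightarrow> f U \<in> U" for f F F'
    using that S'(1) by (intro add.finprod_mono_neutral_cong_left) (auto simp: subset_iff)
  show "additive_subgroup (sum_of_subgroups G \<S>) G"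
    unfolding additive_subgroup_iff[OF abelian_group_axioms]
  proof (intro conjI ballI)
    show "sum_of_subgroups G \<S> \<subseteq> carrier G"
      by (rule least) (use S'(1) in \<open>auto simp: additive_subgroup_def add.subgroup_self\<close>)
    show "\<zero> \<in> sum_of_subgroups G \<S>" using I[of "{}"] by simp
  next
    fix x y assume xy: "x \<in> sum_of_subgroups G \<S>" "y \<in> sum_of_subgroups G \<S>"
    obtain f F where x: "x = finsum G f F" "finite F" "F \<subseteq> \<S>" "\<And>U. U \<in> F \<Longrightarrow> f U \<in> U"
      using xy(1) unfolding sum_of_subgroups_def by blast
    obtain g H where y: "y = finsum G g H" "finite H" "H \<subseteq> \<S>" "\<And>U. U \<in> H \<Longrightarrow> g U \<in> U"
      using xy(2) unfolding sum_of_subgroups_def by blast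
    define f' where "f' = (\<lambda>U. if U \<in> F then f U else \<zero>)"
    define g' where "g' = (\<lambda>U. if U \<in> H then g U else \<zero>)"
    have fg: "f' U \<in> U" "g' U \<in> U" if "U \<in> F \<union> H" for U
      using that x(3,4) y(3,4) S'(2) by (auto simp: f'_def g'_def)
    have "x = finsum G f' (F \<union> H)" "y = finsum G g' (F \<union> H)"
      using x y extend[of "F \<union> H" F f] extend[of "F \<union> H" H g] by (simp_all add: f'_def g'_def)
    moreover have "finsum G (\<lambda>U. f' U \<oplus> g' U) (F \<union> H) = finsum G f' (F \<union> H) \<oplus> finsum G g' (F \<union> H)"
      using fg x(3) y(3) S'(1) by (intro finsum_addf) (auto simp: subset_iff)
    moreover have "finsum G (\<lambda>U. f' U \<oplus> g' U) (F \<union> H) \<in> sum_of_subgroups G \<S>"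
      using fg x(2,3) y(2,3) S'(3) by (intro I) (auto simp: subset_iff)
    ultimately show "x \<oplus> y \<in> sum_of_subgroups G \<S>" by simp
  next
    fix x assume "x \<in> sum_of_subgroups G \<S>"
    then obtain f F where x: "x = finsum G f F" "finite F" "F \<subseteq> \<S>" "\<And>U. U \<in> F \<Longrightarrow> f U \<in> U"
      unfolding sum_of_subgroups_def by blast
    have c: "f U \<in> carrier G" if "U \<in> F" for U using x that S'(1) by blast
    have "finsum G (\<lambda>U. \<ominus> f U) F \<oplus> x = finsum G (\<lambda>U. \<ominus> f U \<oplus> f U) F"
      unfolding x(1) using c by (intro finsum_addf[symmetric]) auto
    also have "\<dots> = finsum G (\<lambda>U. \<zero>) F"
      using c by (intro finsum_cong') (auto simp: l_neg)
    also have "\<dots> = \<zero>" by simp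
    finally show "\<exists>y\<in>sum_of_subgroups G \<S>. y \<oplus> x = \<zero>"
      using I[OF x(2,3), of "\<lambda>U. \<ominus> f U"] x(3,4) S'(4) by blast
  qed
  show "U \<subseteq> sum_of_subgroups G \<S>" if U: "U \<in> \<S>"
  proof
    fix x assume "x \<in> U"
    then show "x \<in> sum_of_subgroups G \<S>"
      using I[of "{U}" "\<lambda>_. x"] U S'(1) by (simp add: finsum_insert Pi_def)
  qed
qed

text \<open>Both right multiplication by an element and projection to a homogeneous component are maps
  \<open>p\<close> of this kind, so sums of graded right ideals are graded right ideals.\<close>

lemma (in abelian_group) sum_of_subgroups_map:
  assumes S: "\<And>U. U \<in> \<S> \<Longrightarrow> additive_subgroup U G"
    and p: "\<And>x. x \<in> carrier G \<Longrightarrow> p x \<in> carrier G"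
    and p_add: "\<And>x y. \<lbrakk>x \<in> carrier G; y \<in> carrier G\<rbrakk> \<Longrightarrow> p (x \<oplus> y) = p x \<oplus> p y"
    and p_in: "\<And>U x. \<lbrakk>U \<in> \<S>; x \<in> U\<rbrakk> \<Longrightarrow> p x \<in> U"
    and x: "x \<in> sum_of_subgroups G \<S>"
  shows "p x \<in> sum_of_subgroups G \<S>"
proof -
  obtain f F where f: "x = finsum G f F" "finite F" "F \<subseteq> \<S>" "\<And>U. U \<in> F \<Longrightarrow> f U \<in> U"
    using x unfolding sum_of_subgroups_def by blast
  have "additive_subgroup (carrier G) G"
    by (simp add: additive_subgroup_def add.subgroup_self)
  then have "p x = finsum G (\<lambda>U. p (f U)) F"
    unfolding f(1) using f S p p_add additive_subgroup_elim(1)[OF S abelian_group_axioms]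
    by (intro additive_map_finsum) auto
  then show ?thesis unfolding sum_of_subgroups_def using f(2-4) p_in by blast
qed

text \<open>\<open>L\<close> is the predicate that selects the right ideals under consideration. The covers of \<open>J\<close> are
  the atoms above \<open>J\<close>; for \<open>J = 0\<close> they are the simple members of \<open>L\<close>.\<close>

definition covers :: "('a set \<Rightarrow> bool) \<Rightarrow> 'a set \<Rightarrow> 'a set \<Rightarrow> bool"
  where "covers L J U \<longleftrightarrow> L U \<and> J \<subseteq> U \<and> U \<noteq> J \<and> (\<forall>V. L V \<and> J \<subseteq> V \<and> V \<subseteq> U \<longrightarrow> V = J \<or> V = U)"

text \<open>In a complete lattice \<open>L\<close> with top \<open>T\<close> this says that \<open>T\<close> is the join of \<open>J\<close> and of the covers
  of \<open>J\<close>. Speaking of upper bounds instead of joins avoids sums of ideals.\<close>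

definition generated_by_covers :: "('a set \<Rightarrow> bool) \<Rightarrow> 'a set \<Rightarrow> 'a set \<Rightarrow> bool"
  where "generated_by_covers L J T \<longleftrightarrow>
    (\<forall>W. L W \<and> J \<subseteq> W \<and> (\<forall>U. covers L J U \<longrightarrow> U \<subseteq> W) \<longrightarrow> W = T)"

text \<open>All quantifiers range over the members of \<open>L\<close> above \<open>J\<close>, so the notion is visibly invariant
  under isomorphisms of this interval.\<close>

lemma generated_by_covers_iff:
  "generated_by_covers L J T \<longleftrightarrow> (\<forall>W. L W \<and> J \<subseteq> W \<longrightarrow>
    (\<forall>U. L U \<and> J \<subseteq> U \<longrightarrow> covers L J U \<longrightarrow> U \<subseteq> W) \<longrightarrow> W = T)"
proof -
  have eq: "(\<forall>U. covers L J U \<longrightarrow> U \<subseteq> W) \<longleftrightarrow>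
      (\<forall>U. L U \<and> J \<subseteq> U \<longrightarrow> covers L J U \<longrightarrow> U \<subseteq> W)" for W
    by (auto simp: covers_def)
  show ?thesis unfolding generated_by_covers_def eq by (simp only: imp_conjL)
qed

lemma generated_by_covers_transfer:
  assumes L': "\<And>V. L' V \<longleftrightarrow> (\<exists>U. L U \<and> J \<subseteq> U \<and> V = \<pi> U)"
    and order: "\<And>U W. \<lbrakk>L U; J \<subseteq> U; L W; J \<subseteq> W\<rbrakk> \<Longrightarrow> \<pi> U \<subseteq> \<pi> W \<longleftrightarrow> U \<subseteq> W"
    and J: "L J" and T: "L T" "J \<subseteq> T"
  shows "generated_by_covers L' (\<pi> J) (\<pi> T) \<longleftrightarrow> generated_by_covers L J T"
proof -
  have eq: "\<pi> U = \<pi> W \<longleftrightarrow> U = W" if "L U" "J \<subseteq> U" "L W" "J \<subseteq> W" for U W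
    using order[OF that] order[OF that(3,4,1,2)] by auto
  have all: "(\<forall>V. L' V \<and> \<pi> J \<subseteq> V \<longrightarrow> P V) \<longleftrightarrow> (\<forall>U. L U \<and> J \<subseteq> U \<longrightarrow> P (\<pi> U))" for P
  proof (intro iffI allI impI)
    fix U assume P: "\<forall>V. L' V \<and> \<pi> J \<subseteq> V \<longrightarrow> P V" and U: "L U \<and> J \<subseteq> U"
    then have "L' (\<pi> U)" "\<pi> J \<subseteq> \<pi> U" using L' order[OF J subset_refl] by blast+
    then show "P (\<pi> U)" using P by blast
  next
    fix V assume P: "\<forall>U. L U \<and> J \<subseteq> U \<longrightarrow> P (\<pi> U)" and "L' V \<and> \<pi> J \<subseteq> V"
    then obtain U where "L U" "J \<subseteq> U" "V = \<pi> U" using L' by blast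
    then show "P V" using P by blast
  qed
  have cov: "covers L' (\<pi> J) (\<pi> U) \<longleftrightarrow> covers L J U" if U: "L U" "J \<subseteq> U" for U
  proof -
    have "covers L' (\<pi> J) (\<pi> U) \<longleftrightarrow> \<pi> U \<noteq> \<pi> J \<and>
        (\<forall>V. L' V \<and> \<pi> J \<subseteq> V \<longrightarrow> V \<subseteq> \<pi> U \<longrightarrow> V = \<pi> J \<or> V = \<pi> U)"
      unfolding covers_def using L' U order[OF J subset_refl U] by blast
    also have "\<dots> \<longleftrightarrow> covers L J U"
      unfolding all covers_def using U eq[OF U J subset_refl] eq[OF _ _ J subset_refl] eq[OF _ _ U]
        order[OF _ _ U] by auto
    finally show ?thesis .
  qed
  show ?thesis
    unfolding generated_by_covers_iff all
    by (simp add: cov order eq T cong: imp_cong conj_cong)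
qed

context nonunital_ring
begin

lemma zero_mult: "x \<in> carrier R \<Longrightarrow> \<zero> \<otimes> x = \<zero>"
  and minus_mult: "\<lbrakk>x \<in> carrier R; y \<in> carrier R\<rbrakk> \<Longrightarrow> (\<ominus> y) \<otimes> x = \<ominus> (y \<otimes> x)"
  using additive_map_zero_minus[of "carrier R" "\<lambda>y. y \<otimes> x"] m_closed l_distr
  by (auto simp: additive_subgroup_def add.subgroup_self)

lemma mult_zero: "x \<in> carrier R \<Longrightarrow> x \<otimes> \<zero> = \<zero>"
  and mult_minus: "\<lbrakk>x \<in> carrier R; y \<in> carrier R\<rbrakk> \<Longrightarrow> x \<otimes> (\<ominus> y) = \<ominus> (x \<otimes> y)"
  using additive_map_zero_minus[of "carrier R" "\<lambda>y. x \<otimes> y"] m_closed r_distr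
  by (auto simp: additive_subgroup_def add.subgroup_self)

lemma right_idealD:
  assumes "right_ideal U R"
  shows "additive_subgroup U R" "x \<in> U \<Longrightarrow> x \<in> carrier R" "\<zero> \<in> U"
    "\<lbrakk>x \<in> U; y \<in> U\<rbrakk> \<Longrightarrow> x \<oplus> y \<in> U" "x \<in> U \<Longrightarrow> \<ominus> x \<in> U" "\<lbrakk>x \<in> U; y \<in> U\<rbrakk> \<Longrightarrow> x \<ominus> y \<in> U"
    "\<lbrakk>x \<in> U; y \<in> carrier R\<rbrakk> \<Longrightarrow> x \<otimes> y \<in> U"
  using additive_subgroup_elim[OF _ abelian_group_axioms] assms unfolding right_ideal_def by blast+

lemma carrier_right_ideal: "right_ideal (carrier R) R"
  unfolding right_ideal_def using m_closed by (simp add: additive_subgroup_def add.subgroup_self)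

lemma right_ideal_Inter:
  assumes "\<And>U. U \<in> \<U> \<Longrightarrow> right_ideal U R"
  shows "right_ideal (carrier R \<inter> \<Inter>\<U>) R"
  unfolding right_ideal_def additive_subgroup_iff[OF abelian_group_axioms]
proof (intro conjI ballI)
  fix x assume x: "x \<in> carrier R \<inter> \<Inter>\<U>"
  then show "\<exists>y\<in>carrier R \<inter> \<Inter>\<U>. y \<oplus> x = \<zero>"
    using right_idealD(5)[OF assms] by (intro bexI[of _ "\<ominus> x"]) (auto simp: l_neg)
qed (use right_idealD[OF assms] m_closed in auto)

end

context decomposed_ring
begin

lemma graded_right_idealD:
  assumes "graded_right_ideal \<Gamma> R A U"
  shows "right_ideal U R" "x \<in> U \<Longrightarrow> comp x \<gamma> \<in> U"
  using assms comp_outside right_idealD(2,3) unfolding graded_right_ideal_iff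
  by (auto, metis)

lemma carrier_graded: "graded_right_ideal \<Gamma> R A (carrier R)"
  unfolding graded_right_ideal_iff using carrier_right_ideal comp_closed by blast

lemma graded_right_ideal_Inter:
  assumes "\<And>U. U \<in> \<U> \<Longrightarrow> graded_right_ideal \<Gamma> R A U"
  shows "graded_right_ideal \<Gamma> R A (carrier R \<inter> \<Inter>\<U>)"
  using right_ideal_Inter[of \<U>] assms comp_closed unfolding graded_right_ideal_iff by auto

lemma gr_simple_iff_covers: "gr_simple \<Gamma> R A U \<longleftrightarrow> covers (graded_right_ideal \<Gamma> R A) {\<zero>} U"
  unfolding gr_simple_def covers_def using graded_right_idealD(1) right_idealD(3) by blast

text \<open>If \<open>R\<close> is generated by gr-simple right ideals, their sum is a graded right ideal that contains
  them all, hence is \<open>R\<close>; the converse holds because a subgroup containing the summands contains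
  their sum.\<close>

lemma gr_semisimple_iff:
  "gr_semisimple \<Gamma> R A \<longleftrightarrow> generated_by_covers (graded_right_ideal \<Gamma> R A) {\<zero>} (carrier R)"
proof
  assume "gr_semisimple \<Gamma> R A"
  then obtain \<S> where S: "\<And>U. U \<in> \<S> \<Longrightarrow> gr_simple \<Gamma> R A U" "carrier R = sum_of_subgroups R \<S>"
    unfolding gr_semisimple_def by blast
  have sub: "additive_subgroup U R" if "U \<in> \<S>" for U
    using S(1)[OF that] graded_right_idealD(1) right_idealD(1) unfolding gr_simple_def by blast
  show "generated_by_covers (graded_right_ideal \<Gamma> R A) {\<zero>} (carrier R)"
    unfolding generated_by_covers_def
  proof (intro allI impI)
    fix W assume W: "graded_right_ideal \<Gamma> R A W \<and> {\<zero>} \<subseteq> W \<and>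
      (\<forall>U. covers (graded_right_ideal \<Gamma> R A) {\<zero>} U \<longrightarrow> U \<subseteq> W)"
    then have r: "right_ideal W R" using graded_right_idealD(1) by blast
    have "carrier R \<subseteq> W"
      unfolding S(2) using W S(1) gr_simple_iff_covers
      by (intro sum_of_subgroups_least[OF sub right_idealD(1)[OF r]]) auto
    then show "W = carrier R" using right_idealD(2)[OF r] by blast
  qed
next
  assume g: "generated_by_covers (graded_right_ideal \<Gamma> R A) {\<zero>} (carrier R)"
  let ?S = "{U. gr_simple \<Gamma> R A U}"
  have gr: "graded_right_ideal \<Gamma> R A U" if "U \<in> ?S" for U
    using that unfolding gr_simple_def by blast
  note sub = right_idealD(1)[OF graded_right_idealD(1)[OF gr]]
  let ?W = "sum_of_subgroups R ?S"
  have W: "additive_subgroup ?W R" by (rule sum_of_subgroups_subgroup[OF sub])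
  have "graded_right_ideal \<Gamma> R A ?W"
    unfolding graded_right_ideal_iff right_ideal_def
  proof (intro conjI ballI)
    fix x y assume x: "x \<in> ?W" and y: "y \<in> carrier R"
    show "x \<otimes> y \<in> ?W"
      by (rule sum_of_subgroups_map[OF sub _ _ _ x])
        (use y m_closed l_distr right_idealD(7)[OF graded_right_idealD(1)[OF gr]] in auto)
  next
    fix x \<gamma> assume x: "x \<in> ?W"
    show "comp x \<gamma> \<in> ?W"
      by (rule sum_of_subgroups_map[OF sub _ _ _ x, of "\<lambda>x. comp x \<gamma>"])
        (use comp_closed comp_add graded_right_idealD(2)[OF gr] in auto)
  qed (rule W)
  moreover have "U \<subseteq> ?W" if "gr_simple \<Gamma> R A U" for U
    by (rule sum_of_subgroups_upper[OF sub]) (use that in auto)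
  ultimately have "?W = carrier R"
    using g additive_subgroup_elim(2)[OF W abelian_group_axioms]
    unfolding generated_by_covers_def gr_simple_iff_covers by blast
  then show "gr_semisimple \<Gamma> R A" unfolding gr_semisimple_def by blast
qed

end

section \<open>Quotients by graded ideals\<close>

context decomposed_ring
begin

context
  fixes J
  assumes J: "graded_right_ideal \<Gamma> R A J"
    and J_left: "\<And>x y. \<lbrakk>x \<in> carrier R; y \<in> J\<rbrakk> \<Longrightarrow> x \<otimes> y \<in> J"
begin

lemmas J_right = graded_right_idealD(1)[OF J]
lemmas J_ideal = right_idealD[OF J_right]

lemma J_abelian_subgroup: "abelian_subgroup J R"
  by (rule abelian_subgroupI3[OF J_ideal(1) abelian_group_axioms])

lemma coset_eq_iff:
  assumes "x \<in> carrier R" "y \<in> carrier R"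
  shows "J +> x = J +> y \<longleftrightarrow> x \<ominus> y \<in> J"
proof -
  interpret abelian_subgroup J R by (rule J_abelian_subgroup)
  show ?thesis
    using assms a_rcos_module_minus[of y x] a_repr_independence'[of x y] a_repr_independenceD[of x y]
      nonunital_ring_axioms
    by (metis a_rcos_self a_rcos_module a_minus_def)
qed

lemma coset_subset_iff:
  assumes "right_ideal U R" "J \<subseteq> U" "x \<in> carrier R"
  shows "J +> x \<in> (+>) J ` U \<longleftrightarrow> x \<in> U"
proof
  assume "J +> x \<in> (+>) J ` U"
  then obtain y where y: "y \<in> U" "J +> x = J +> y" by blast
  then have "x \<ominus> y \<in> U" using assms coset_eq_iff right_idealD(2) by blast
  then have "(x \<ominus> y) \<oplus> y \<in> U" using y right_idealD(4)[OF assms(1)] by blast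
  moreover have "(x \<ominus> y) \<oplus> y = x"
    using assms y right_idealD(2)[OF assms(1)] by (simp add: a_minus_def a_assoc l_neg)
  ultimately show "x \<in> U" by simp
qed simp

lemma quotient_carrier: "carrier (R Quot J) = (+>) J ` carrier R"
  unfolding FactRing_def by (auto simp: A_RCOSETS_def' a_r_coset_def')

lemma quotient_zero: "\<zero>\<^bsub>R Quot J\<^esub> = J"
  by (simp add: FactRing_def)

lemma coset_zero_iff: "x \<in> carrier R \<Longrightarrow> J +> x = J \<longleftrightarrow> x \<in> J"
  using coset_eq_iff[of x \<zero>] a_coset_add_zero[OF additive_subgroup.a_subset[OF J_ideal(1)]]
    minus_equality[of \<zero> \<zero>] by (simp add: a_minus_def)

lemma coset_J: "x \<in> J \<Longrightarrow> J +> x = J"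
  using coset_zero_iff J_ideal(2) by simp

lemma quotient_add:
  "\<lbrakk>x \<in> carrier R; y \<in> carrier R\<rbrakk> \<Longrightarrow> (J +> x) \<oplus>\<^bsub>R Quot J\<^esub> (J +> y) = J +> (x \<oplus> y)"
  using abelian_subgroup.a_rcos_sum[OF J_abelian_subgroup] by (simp add: FactRing_def)

lemma in_coset: "\<lbrakk>x \<in> carrier R; a \<in> J +> x\<rbrakk> \<Longrightarrow> a \<in> carrier R \<and> a \<ominus> x \<in> J"
  by (auto simp: a_r_coset_def' a_minus_def a_assoc r_neg J_ideal(2))

lemma quotient_mult:
  assumes x: "x \<in> carrier R" and y: "y \<in> carrier R"
  shows "(J +> x) \<otimes>\<^bsub>R Quot J\<^esub> (J +> y) = J +> (x \<otimes> y)"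
proof -
  have eq: "J +> (a \<otimes> b) = J +> (x \<otimes> y)" if ab: "a \<in> J +> x" "b \<in> J +> y" for a b
  proof -
    have c: "a \<in> carrier R" "b \<in> carrier R" "a \<ominus> x \<in> J" "b \<ominus> y \<in> J"
      using in_coset ab x y by blast+
    have "(a \<ominus> x) \<otimes> b \<oplus> x \<otimes> (b \<ominus> y) = (a \<otimes> b \<ominus> x \<otimes> b) \<oplus> (x \<otimes> b \<ominus> x \<otimes> y)"
      using c x y by (simp add: a_minus_def l_distr r_distr minus_mult mult_minus)
    also have "\<dots> = a \<otimes> b \<oplus> ((\<ominus> (x \<otimes> b) \<oplus> x \<otimes> b) \<oplus> \<ominus> (x \<otimes> y))"
      using c x y m_closed by (simp add: a_minus_def a_assoc)
    also have "\<dots> = a \<otimes> b \<ominus> x \<otimes> y"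
      using c x y m_closed by (simp add: a_minus_def l_neg)
    finally have "a \<otimes> b \<ominus> x \<otimes> y \<in> J"
      using J_ideal(4)[OF J_ideal(7)[OF c(3,2)] J_left[OF x c(4)]] by simp
    then show ?thesis using coset_eq_iff c x y m_closed by blast
  qed
  have "J +> x \<noteq> {}" "J +> y \<noteq> {}"
    using abelian_subgroup.a_rcos_self[OF J_abelian_subgroup] x y by blast+
  moreover have "rcoset_mult R J (J +> x) (J +> y) = (\<Union>a\<in>J +> x. \<Union>b\<in>J +> y. J +> (x \<otimes> y))"
    unfolding rcoset_mult_def by (intro SUP_cong refl eq)
  ultimately have "rcoset_mult R J (J +> x) (J +> y) = J +> (x \<otimes> y)" by simp
  then show ?thesis by (simp add: FactRing_def)
qed

lemma quotient_abelian_group: "abelian_group (R Quot J)"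
proof -
  interpret abelian_subgroup J R by (rule J_abelian_subgroup)
  show ?thesis
    by (rule comm_group_abelian_groupI)
      (simp add: FactRing_def a_factorgroup_is_comm_group[unfolded A_FactGroup_def'])
qed

lemma quotient_nonunital_ring: "nonunital_ring (R Quot J)"
proof -
  interpret Q: abelian_group "R Quot J" by (rule quotient_abelian_group)
  show ?thesis
    by standard (auto simp: quotient_carrier quotient_mult quotient_add m_closed l_distr r_distr m_assoc)
qed

lemma quotient_image_subgroup:
  assumes U: "additive_subgroup U R"
  shows "additive_subgroup ((+>) J ` U) (R Quot J)"
proof -
  note U' = additive_subgroup_elim[OF U abelian_group_axioms]
  show ?thesis
    unfolding additive_subgroup_iff[OF quotient_abelian_group] quotient_zero
  proof (intro conjI ballI)
    show "(+>) J ` U \<subseteq> carrier (R Quot J)" using U'(1) quotient_carrier by auto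
    show "J \<in> (+>) J ` U" using U'(2) coset_zero_iff[of \<zero>] J_ideal(3) by force
  next
    fix C D assume "C \<in> (+>) J ` U" "D \<in> (+>) J ` U"
    then show "C \<oplus>\<^bsub>R Quot J\<^esub> D \<in> (+>) J ` U" using U'(1,3) quotient_add by auto
  next
    fix C assume "C \<in> (+>) J ` U"
    then obtain x where x: "x \<in> U" "C = J +> x" by blast
    then have "(J +> (\<ominus> x)) \<oplus>\<^bsub>R Quot J\<^esub> C = J"
      using U'(1)[OF x(1)] quotient_add[of "\<ominus> x" x] coset_zero_iff[of \<zero>] J_ideal(3) by (simp add: l_neg)
    then show "\<exists>D\<in>(+>) J ` U. D \<oplus>\<^bsub>R Quot J\<^esub> C = J" using U'(4) x(1) by blast
  qed
qed

lemma coset_comp: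
  assumes "x \<in> carrier R" "y \<in> carrier R" "J +> x = J +> y"
  shows "J +> comp x \<gamma> = J +> comp y \<gamma>"
proof -
  have "comp (x \<ominus> y) \<gamma> \<in> J" using assms graded_right_idealD(2)[OF J] coset_eq_iff by blast
  then show ?thesis
    using assms coset_eq_iff comp_closed comp_add comp_minus by (simp add: a_minus_def)
qed

text \<open>The projections of \<open>R\<close> preserve cosets of the graded ideal \<open>J\<close> and therefore descend to
  projections of \<open>R/J\<close>.\<close>

lemma quotient_decomposed_ring: "decomposed_ring \<Gamma> (R Quot J) (quotient_grading R J A)"
proof -
  interpret Q: nonunital_ring "R Quot J" by (rule quotient_nonunital_ring)
  \<comment> \<open>An arbitrary representative of the coset serves, by \<open>coset_comp\<close>.\<close>
  define p where "p = (\<lambda>\<gamma> C. J +> comp (SOME x. x \<in> carrier R \<and> C = J +> x) \<gamma>)"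
  have p: "p \<gamma> (J +> x) = J +> comp x \<gamma>" if x: "x \<in> carrier R" for \<gamma> x
  proof -
    let ?y = "SOME y. y \<in> carrier R \<and> J +> x = J +> y"
    have "?y \<in> carrier R \<and> J +> x = J +> ?y" by (rule someI[of _ x]) (simp add: x)
    then show ?thesis unfolding p_def using coset_comp[OF _ x] by metis
  qed
  show ?thesis
  proof (intro decomposed_ring.intro decomposed_ring_axioms.intro)
    show "nonunital_ring (R Quot J)" by (rule quotient_nonunital_ring)
    show sub: "additive_subgroup (quotient_grading R J A \<gamma>) (R Quot J)" if "\<gamma> \<in> Mor \<Gamma>" for \<gamma>
      unfolding quotient_grading_def by (rule quotient_image_subgroup[OF component_subgroup[OF that]])
    show "internal_direct_sum (R Quot J) (Mor \<Gamma>) (quotient_grading R J A) (carrier (R Quot J))"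
    proof (rule Q.internal_direct_sumI[where p = p])
      show "additive_subgroup (carrier (R Quot J)) (R Quot J)"
        by (rule right_ideal_def[THEN iffD1, THEN conjunct1, OF Q.carrier_right_ideal])
      show "quotient_grading R J A \<gamma> \<subseteq> carrier (R Quot J)" if "\<gamma> \<in> Mor \<Gamma>" for \<gamma>
        using additive_subgroup.a_subset[OF sub[OF that]] .
    next
      fix \<gamma> C assume \<gamma>: "\<gamma> \<in> Mor \<Gamma>" and "C \<in> carrier (R Quot J)"
      then obtain x where x: "x \<in> carrier R" "C = J +> x" unfolding quotient_carrier by blast
      then show "p \<gamma> C \<in> quotient_grading R J A \<gamma>"
        using p comp_in[OF x(1) \<gamma>] by (simp add: quotient_grading_def)
    next
      fix \<gamma> C D assume "\<gamma> \<in> Mor \<Gamma>" "C \<in> carrier (R Quot J)" "D \<in> carrier (R Quot J)"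
      then show "p \<gamma> (C \<oplus>\<^bsub>R Quot J\<^esub> D) = p \<gamma> C \<oplus>\<^bsub>R Quot J\<^esub> p \<gamma> D"
        unfolding quotient_carrier by (auto simp: quotient_add p comp_add comp_closed)
    next
      fix \<gamma> C assume \<gamma>: "\<gamma> \<in> Mor \<Gamma>" and "C \<in> quotient_grading R J A \<gamma>"
      then obtain x where x: "x \<in> A \<gamma>" "C = J +> x" unfolding quotient_grading_def by blast
      show "p \<gamma> C = C" using x p[OF component(1)[OF \<gamma> x(1)]] comp_homogeneous[OF x(1) \<gamma>] by simp
      show "p \<delta> C = \<zero>\<^bsub>R Quot J\<^esub>" if "\<gamma> \<noteq> \<delta>" for \<delta>
        using x p[OF component(1)[OF \<gamma> x(1)]] comp_homogeneous[OF x(1) \<gamma>] that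
          coset_zero_iff[of \<zero>] J_ideal(3) by (simp add: quotient_zero)
    next
      fix C assume "C \<in> carrier (R Quot J)"
      then obtain x where x: "x \<in> carrier R" "C = J +> x" unfolding quotient_carrier by blast
      have "{\<gamma> \<in> Mor \<Gamma>. p \<gamma> C \<noteq> \<zero>\<^bsub>R Quot J\<^esub>} \<subseteq> {\<gamma>. comp x \<gamma> \<noteq> \<zero>}"
        using x p coset_zero_iff[of \<zero>] J_ideal(3) by (auto simp: quotient_zero)
      then show "finite {\<gamma> \<in> Mor \<Gamma>. p \<gamma> C \<noteq> \<zero>\<^bsub>R Quot J\<^esub>}"
        by (rule finite_subset) (rule comp_finite[OF x(1)])
      assume "\<And>\<gamma>. \<gamma> \<in> Mor \<Gamma> \<Longrightarrow> p \<gamma> C = \<zero>\<^bsub>R Quot J\<^esub>"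
      then have "comp x \<gamma> \<in> J" if "\<gamma> \<in> Mor \<Gamma>" for \<gamma>
        using x p that coset_zero_iff[OF comp_closed[OF x(1)]] by (simp add: quotient_zero)
      then have "x \<in> J" by (rule in_subgroup_if_components_in[OF J_ideal(1) x(1)])
      then show "C = \<zero>\<^bsub>R Quot J\<^esub>" using x coset_zero_iff by (simp add: quotient_zero)
    qed
  qed
qed

lemma quotient_comp:
  assumes "x \<in> carrier R"
  shows "homogeneous_component (R Quot J) (Mor \<Gamma>) (quotient_grading R J A) (J +> x) \<gamma> = J +> comp x \<gamma>"
proof -
  interpret Q: decomposed_ring \<Gamma> "R Quot J" "quotient_grading R J A"
    by (rule quotient_decomposed_ring)
  have zero: "J +> \<zero> = \<zero>\<^bsub>R Quot J\<^esub>" using coset_zero_iff[of \<zero>] J_ideal(3) by (simp add: quotient_zero)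
  from assms show ?thesis
  proof (induction rule: homogeneous_induct)
    case zero
    show ?case unfolding comp_zero \<open>J +> \<zero> = \<zero>\<^bsub>R Quot J\<^esub>\<close> by (rule Q.comp_zero)
  next
    case (homogeneous \<delta> a)
    then have "J +> a \<in> quotient_grading R J A \<delta>" by (simp add: quotient_grading_def)
    then show ?case using Q.comp_homogeneous comp_homogeneous homogeneous zero by simp
  next
    case (add y z)
    then show ?case
      using Q.comp_add[of "J +> y" "J +> z"] comp_closed
      by (simp add: quotient_carrier quotient_add comp_add)
  qed
qed

text \<open>The correspondence theorem: the graded right ideal of \<open>R\<close> belonging to \<open>V\<close> is its preimage.\<close>

lemma quotient_graded_right_ideal_iff:
  "graded_right_ideal \<Gamma> (R Quot J) (quotient_grading R J A) V \<longleftrightarrow>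
    (\<exists>U. graded_right_ideal \<Gamma> R A U \<and> J \<subseteq> U \<and> V = (+>) J ` U)"
proof -
  interpret Q: decomposed_ring \<Gamma> "R Quot J" "quotient_grading R J A"
    by (rule quotient_decomposed_ring)
  show ?thesis
  proof
    assume V: "graded_right_ideal \<Gamma> (R Quot J) (quotient_grading R J A) V"
    note V' = Q.right_idealD[OF Q.graded_right_idealD(1)[OF V]]
    let ?U = "{x \<in> carrier R. J +> x \<in> V}"
    have "graded_right_ideal \<Gamma> R A ?U"
      unfolding graded_right_ideal_iff right_ideal_def additive_subgroup_iff[OF abelian_group_axioms]
    proof (intro conjI ballI)
      show "\<zero> \<in> ?U" using V'(3) coset_zero_iff[of \<zero>] J_ideal(3) by (simp add: quotient_zero)
    next
      fix x y assume "x \<in> ?U" "y \<in> ?U"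
      then show "x \<oplus> y \<in> ?U" using V'(4)[of "J +> x" "J +> y"] quotient_add[of x y] by auto
    next
      fix x y assume "x \<in> ?U" "y \<in> carrier R"
      then show "x \<otimes> y \<in> ?U"
        using V'(7)[of "J +> x" "J +> y"] quotient_mult[of x y] m_closed by (auto simp: quotient_carrier)
    next
      fix x \<gamma> assume "x \<in> ?U" "\<gamma> \<in> Mor \<Gamma>"
      then show "comp x \<gamma> \<in> ?U"
        using Q.graded_right_idealD(2)[OF V, of "J +> x" \<gamma>] quotient_comp comp_closed by auto
    next
      fix x assume x: "x \<in> ?U"
      have "(J +> (\<ominus> x)) \<oplus>\<^bsub>R Quot J\<^esub> (J +> x) = \<zero>\<^bsub>R Quot J\<^esub>"
        using x quotient_add[of "\<ominus> x" x] coset_zero_iff[of \<zero>] J_ideal(3)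
        by (simp add: l_neg quotient_zero)
      then have "J +> (\<ominus> x) = \<ominus>\<^bsub>R Quot J\<^esub> (J +> x)"
        using x by (intro Q.minus_equality[symmetric]) (auto simp: quotient_carrier)
      then show "\<exists>y\<in>?U. y \<oplus> x = \<zero>"
        using x V'(5) by (intro bexI[of _ "\<ominus> x"]) (auto simp: l_neg)
    qed auto
    moreover have "J \<subseteq> ?U" using J_ideal(2) coset_J V'(3) by (auto simp: quotient_zero)
    moreover have "V = (+>) J ` ?U" using V'(2) by (auto simp: quotient_carrier)
    ultimately show "\<exists>U. graded_right_ideal \<Gamma> R A U \<and> J \<subseteq> U \<and> V = (+>) J ` U" by blast
  next
    assume "\<exists>U. graded_right_ideal \<Gamma> R A U \<and> J \<subseteq> U \<and> V = (+>) J ` U"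
    then obtain U where U: "graded_right_ideal \<Gamma> R A U" "J \<subseteq> U" "V = (+>) J ` U" by blast
    note U' = right_idealD[OF graded_right_idealD(1)[OF U(1)]]
    show "graded_right_ideal \<Gamma> (R Quot J) (quotient_grading R J A) V"
      unfolding Q.graded_right_ideal_iff right_ideal_def U(3)
    proof (intro conjI ballI)
      show "additive_subgroup ((+>) J ` U) (R Quot J)" by (rule quotient_image_subgroup[OF U'(1)])
    next
      fix C D assume "C \<in> (+>) J ` U" "D \<in> carrier (R Quot J)"
      then show "C \<otimes>\<^bsub>R Quot J\<^esub> D \<in> (+>) J ` U"
        using U'(2,7) by (auto simp: quotient_carrier quotient_mult)
    next
      fix C \<gamma> assume "C \<in> (+>) J ` U"
      then show "homogeneous_component (R Quot J) (Mor \<Gamma>) (quotient_grading R J A) C \<gamma> \<in> (+>) J ` U"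
        using U'(2) graded_right_idealD(2)[OF U(1)] by (auto simp: quotient_comp)
    qed
  qed
qed

lemma quotient_gr_semisimple_iff:
  "gr_semisimple \<Gamma> (R Quot J) (quotient_grading R J A) \<longleftrightarrow>
    generated_by_covers (graded_right_ideal \<Gamma> R A) J (carrier R)"
proof -
  interpret Q: decomposed_ring \<Gamma> "R Quot J" "quotient_grading R J A"
    by (rule quotient_decomposed_ring)
  have image: "(+>) J ` J = {\<zero>\<^bsub>R Quot J\<^esub>}"
    using coset_J J_ideal(3) by (auto simp: quotient_zero image_iff)
  have order: "(+>) J ` U \<subseteq> (+>) J ` W \<longleftrightarrow> U \<subseteq> W"
    if "graded_right_ideal \<Gamma> R A U" "graded_right_ideal \<Gamma> R A W" "J \<subseteq> W" for U W
  proof -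
    have "(+>) J ` U \<subseteq> (+>) J ` W \<longleftrightarrow> (\<forall>x\<in>U. J +> x \<in> (+>) J ` W)" by blast
    also have "\<dots> \<longleftrightarrow> (\<forall>x\<in>U. x \<in> W)"
      using coset_subset_iff[OF graded_right_idealD(1)[OF that(2)] that(3)]
        right_idealD(2)[OF graded_right_idealD(1)[OF that(1)]] by simp
    finally show ?thesis by blast
  qed
  show ?thesis
    unfolding Q.gr_semisimple_iff image[symmetric] quotient_carrier
    by (rule generated_by_covers_transfer[OF quotient_graded_right_ideal_iff])
      (use order J carrier_graded J_ideal(2) in auto)
qed

end

end

section \<open>Multiplication by homogeneous elements and the graded radical\<close>

lemma (in groupoid) left_factor:
  assumes "\<gamma> \<in> Mor \<Gamma>" "\<epsilon> \<in> Mor \<Gamma>" "Cod \<Gamma> \<gamma> = Cod \<Gamma> \<epsilon>"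
  obtains \<delta> where "\<delta> \<in> Mor \<Gamma>" "Dom \<Gamma> \<gamma> = Cod \<Gamma> \<delta>" "Comp \<Gamma> \<gamma> \<delta> = \<epsilon>"
proof -
  obtain \<iota> where \<iota>: "\<iota> \<in> Mor \<Gamma>" "Dom \<Gamma> \<iota> = Cod \<Gamma> \<gamma>" "Cod \<Gamma> \<iota> = Dom \<Gamma> \<gamma>" "Comp \<Gamma> \<gamma> \<iota> = Cod \<Gamma> \<gamma>"
    using inverse_ex[OF assms(1)] by blast
  show ?thesis
  proof
    show "Comp \<Gamma> \<iota> \<epsilon> \<in> Mor \<Gamma>" using \<iota> assms Comp_in by simp
    show "Dom \<Gamma> \<gamma> = Cod \<Gamma> (Comp \<Gamma> \<iota> \<epsilon>)" using \<iota> assms Cod_Comp by simp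
    show "Comp \<Gamma> \<gamma> (Comp \<Gamma> \<iota> \<epsilon>) = \<epsilon>"
      using \<iota> assms Comp_assoc[of \<gamma> \<iota> \<epsilon>] Cod_Comp_left[of \<epsilon>] by simp
  qed
qed

lemma (in groupoid) left_cancel:
  assumes "\<gamma> \<in> Mor \<Gamma>" "\<delta> \<in> Mor \<Gamma>" "\<epsilon> \<in> Mor \<Gamma>" "Dom \<Gamma> \<gamma> = Cod \<Gamma> \<delta>" "Dom \<Gamma> \<gamma> = Cod \<Gamma> \<epsilon>"
    "Comp \<Gamma> \<gamma> \<delta> = Comp \<Gamma> \<gamma> \<epsilon>"
  shows "\<delta> = \<epsilon>"
proof -
  obtain \<iota> where \<iota>: "\<iota> \<in> Mor \<Gamma>" "Dom \<Gamma> \<iota> = Cod \<Gamma> \<gamma>" "Comp \<Gamma> \<iota> \<gamma> = Dom \<Gamma> \<gamma>"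
    using inverse_ex[OF assms(1)] by blast
  have "Comp \<Gamma> \<iota> (Comp \<Gamma> \<gamma> \<zeta>) = \<zeta>" if "\<zeta> \<in> Mor \<Gamma>" "Dom \<Gamma> \<gamma> = Cod \<Gamma> \<zeta>" for \<zeta>
    using Comp_assoc[of \<iota> \<gamma> \<zeta>] \<iota> assms(1) that Cod_Comp_left[of \<zeta>] by simp
  then show ?thesis using assms by metis
qed

lemma (in groupoid) right_cancel:
  assumes "\<gamma> \<in> Mor \<Gamma>" "\<delta> \<in> Mor \<Gamma>" "\<epsilon> \<in> Mor \<Gamma>" "Dom \<Gamma> \<delta> = Cod \<Gamma> \<gamma>" "Dom \<Gamma> \<epsilon> = Cod \<Gamma> \<gamma>"
    "Comp \<Gamma> \<delta> \<gamma> = Comp \<Gamma> \<epsilon> \<gamma>"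
  shows "\<delta> = \<epsilon>"
proof -
  obtain \<iota> where \<iota>: "\<iota> \<in> Mor \<Gamma>" "Cod \<Gamma> \<iota> = Dom \<Gamma> \<gamma>" "Comp \<Gamma> \<gamma> \<iota> = Cod \<Gamma> \<gamma>"
    using inverse_ex[OF assms(1)] by blast
  have "Comp \<Gamma> (Comp \<Gamma> \<zeta> \<gamma>) \<iota> = \<zeta>" if "\<zeta> \<in> Mor \<Gamma>" "Dom \<Gamma> \<zeta> = Cod \<Gamma> \<gamma>" for \<zeta>
    using Comp_assoc[of \<zeta> \<gamma> \<iota>] \<iota> assms(1) that Comp_Dom[of \<zeta>] by simp
  then show ?thesis using assms by metis
qed

lemma (in groupoid) Obj_Mor: "e \<in> Obj \<Gamma> \<Longrightarrow> e \<in> Mor \<Gamma>"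
  and Comp_Obj: "e \<in> Obj \<Gamma> \<Longrightarrow> Comp \<Gamma> e e = e"
  using Obj_subset Comp_Dom[of e] Dom_Obj[of e] by auto

context object_unital_graded_ring
begin

sublocale decomposed_ring \<Gamma> R A
  by (intro decomposed_ring.intro decomposed_ring_axioms.intro nonunital_ring_axioms
      component_subgroup decomposition)

abbreviation local_unit :: "'g \<Rightarrow> 'a"
  where "local_unit e \<equiv> unit_of R (A e)"

lemma local_unit:
  assumes "e \<in> Obj \<Gamma>"
  shows "local_unit e \<in> A e" and "a \<in> A e \<Longrightarrow> local_unit e \<otimes> a = a" and "a \<in> A e \<Longrightarrow> a \<otimes> local_unit e = a"
proof -
  obtain u where u: "u \<in> A e" "\<forall>a\<in>A e. u \<otimes> a = a \<and> a \<otimes> u = a" using unit_ex[OF assms] by blast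
  have "local_unit e = u"
    unfolding unit_of_def
  proof (rule the_equality)
    fix v assume "v \<in> A e \<and> (\<forall>a\<in>A e. v \<otimes> a = a \<and> a \<otimes> v = a)"
    then show "v = u" using u by metis
  qed (use u in simp)
  then show "local_unit e \<in> A e" "a \<in> A e \<Longrightarrow> local_unit e \<otimes> a = a" "a \<in> A e \<Longrightarrow> a \<otimes> local_unit e = a"
    using u by auto
qed

text \<open>Left multiplication by \<open>\<gamma>\<close> is injective on degrees, so \<open>a\<close> times the component of \<open>y\<close> of degree \<open>\<delta>\<close> is
  the only contribution to \<open>ay\<close> in degree \<open>\<gamma>\<delta>\<close>.\<close>

lemma comp_mult_left:
  assumes a: "\<gamma> \<in> Mor \<Gamma>" "a \<in> A \<gamma>" and \<delta>: "\<delta> \<in> Mor \<Gamma>" "Dom \<Gamma> \<gamma> = Cod \<Gamma> \<delta>" and y: "y \<in> carrier R"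
  shows "comp (a \<otimes> y) (Comp \<Gamma> \<gamma> \<delta>) = a \<otimes> comp y \<delta>"
  using y
proof (induction rule: homogeneous_induct)
  case zero
  then show ?case using component(1)[OF a] by (simp add: comp_zero mult_zero)
next
  case (homogeneous \<eta> b)
  have c: "a \<in> carrier R" using component(1)[OF a] .
  show ?case
  proof (cases "Dom \<Gamma> \<gamma> = Cod \<Gamma> \<eta>")
    case True
    have "comp (a \<otimes> b) (Comp \<Gamma> \<gamma> \<delta>) = (if Comp \<Gamma> \<gamma> \<delta> = Comp \<Gamma> \<gamma> \<eta> then a \<otimes> b else \<zero>)"
      by (rule comp_homogeneous[OF mult_composable[OF a(1) homogeneous(1) True a(2) homogeneous(2)]
          Comp_in[OF a(1) homogeneous(1) True]])
    moreover have "Comp \<Gamma> \<gamma> \<delta> = Comp \<Gamma> \<gamma> \<eta> \<longleftrightarrow> \<delta> = \<eta>"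
      using left_cancel[OF a(1) \<delta>(1) homogeneous(1) \<delta>(2) True] by blast
    ultimately show ?thesis
      using comp_homogeneous[OF homogeneous(2,1)] c by (simp add: mult_zero)
  next
    case False
    then have "\<delta> \<noteq> \<eta>" using \<delta>(2) by auto
    then show ?thesis
      using False comp_homogeneous[OF homogeneous(2,1)] c mult_not_composable[OF a(1) homogeneous(1) False a(2) homogeneous(2)]
      by (simp add: mult_zero comp_zero)
  qed
next
  case (add y z)
  then show ?case
    using component(1)[OF a] by (simp add: r_distr comp_add comp_closed m_closed)
qed

lemma comp_mult_left_other:
  assumes a: "\<gamma> \<in> Mor \<Gamma>" "a \<in> A \<gamma>" and \<epsilon>: "Cod \<Gamma> \<epsilon> \<noteq> Cod \<Gamma> \<gamma>" and y: "y \<in> carrier R"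
  shows "comp (a \<otimes> y) \<epsilon> = \<zero>"
  using y
proof (induction rule: homogeneous_induct)
  case zero
  then show ?case using component(1)[OF a] by (simp add: comp_zero mult_zero)
next
  case (homogeneous \<eta> b)
  show ?case
  proof (cases "Dom \<Gamma> \<gamma> = Cod \<Gamma> \<eta>")
    case True
    have "comp (a \<otimes> b) \<epsilon> = (if \<epsilon> = Comp \<Gamma> \<gamma> \<eta> then a \<otimes> b else \<zero>)"
      by (rule comp_homogeneous[OF mult_composable[OF a(1) homogeneous(1) True a(2) homogeneous(2)]
          Comp_in[OF a(1) homogeneous(1) True]])
    then show ?thesis using Cod_Comp[OF a(1) homogeneous(1) True] \<epsilon> by auto
  next
    case False
    then show ?thesis
      using mult_not_composable[OF a(1) homogeneous(1) False a(2) homogeneous(2)] by (simp add: comp_zero)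
  qed
next
  case (add y z)
  then show ?case
    using component(1)[OF a] by (simp add: r_distr comp_add m_closed)
qed

lemma comp_mult_left_cases:
  assumes a: "\<gamma> \<in> Mor \<Gamma>" "a \<in> A \<gamma>" and \<epsilon>: "\<epsilon> \<in> Mor \<Gamma>" and y: "y \<in> carrier R"
  obtains "Cod \<Gamma> \<epsilon> \<noteq> Cod \<Gamma> \<gamma>" "comp (a \<otimes> y) \<epsilon> = \<zero>"
  | \<delta> where "\<delta> \<in> Mor \<Gamma>" "Dom \<Gamma> \<gamma> = Cod \<Gamma> \<delta>" "Comp \<Gamma> \<gamma> \<delta> = \<epsilon>" "comp (a \<otimes> y) \<epsilon> = a \<otimes> comp y \<delta>"
proof (cases "Cod \<Gamma> \<epsilon> = Cod \<Gamma> \<gamma>")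
  case True
  then obtain \<delta> where \<delta>: "\<delta> \<in> Mor \<Gamma>" "Dom \<Gamma> \<gamma> = Cod \<Gamma> \<delta>" "Comp \<Gamma> \<gamma> \<delta> = \<epsilon>"
    using left_factor[OF a(1) \<epsilon>] by metis
  then show ?thesis using that(2) comp_mult_left[OF a \<delta>(1,2) y] by simp
next
  case False
  then show ?thesis using that(1) comp_mult_left_other[OF a False y] by simp
qed

lemma comp_mult_right:
  assumes b: "\<delta> \<in> Mor \<Gamma>" "b \<in> A \<delta>" and \<gamma>: "\<gamma> \<in> Mor \<Gamma>" "Dom \<Gamma> \<gamma> = Cod \<Gamma> \<delta>" and x: "x \<in> carrier R"
  shows "comp (x \<otimes> b) (Comp \<Gamma> \<gamma> \<delta>) = comp x \<gamma> \<otimes> b"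
  using x
proof (induction rule: homogeneous_induct)
  case zero
  then show ?case using component(1)[OF b] by (simp add: comp_zero zero_mult)
next
  case (homogeneous \<eta> a)
  have c: "b \<in> carrier R" using component(1)[OF b] .
  show ?case
  proof (cases "Dom \<Gamma> \<eta> = Cod \<Gamma> \<delta>")
    case True
    have "comp (a \<otimes> b) (Comp \<Gamma> \<gamma> \<delta>) = (if Comp \<Gamma> \<gamma> \<delta> = Comp \<Gamma> \<eta> \<delta> then a \<otimes> b else \<zero>)"
      by (rule comp_homogeneous[OF mult_composable[OF homogeneous(1) b(1) True homogeneous(2) b(2)]
          Comp_in[OF homogeneous(1) b(1) True]])
    moreover have "Comp \<Gamma> \<gamma> \<delta> = Comp \<Gamma> \<eta> \<delta> \<longleftrightarrow> \<gamma> = \<eta>"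
      using right_cancel[OF b(1) \<gamma>(1) homogeneous(1) \<gamma>(2) True] by blast
    ultimately show ?thesis
      using comp_homogeneous[OF homogeneous(2,1)] c by (simp add: zero_mult)
  next
    case False
    then have "\<gamma> \<noteq> \<eta>" using \<gamma>(2) by auto
    then show ?thesis
      using False comp_homogeneous[OF homogeneous(2,1)] c mult_not_composable[OF homogeneous(1) b(1) False homogeneous(2) b(2)]
      by (simp add: zero_mult comp_zero)
  qed
next
  case (add y z)
  then show ?case
    using component(1)[OF b] by (simp add: l_distr comp_add comp_closed m_closed)
qed

text \<open>The transporter \<open>(M : a)\<close> is the kernel of \<open>y \<mapsto> ay + M\<close>. It and its maximality are used to show that the
  graded radical is closed under multiplication from the left.\<close>

lemma left_transporter_graded:
  assumes M: "graded_right_ideal \<Gamma> R A M" and a: "\<gamma> \<in> Mor \<Gamma>" "a \<in> A \<gamma>"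
  shows "graded_right_ideal \<Gamma> R A {y \<in> carrier R. a \<otimes> y \<in> M}" (is "graded_right_ideal \<Gamma> R A ?K")
  unfolding graded_right_ideal_iff right_ideal_def additive_subgroup_iff[OF abelian_group_axioms]
proof (intro conjI ballI)
  note M' = right_idealD[OF graded_right_idealD(1)[OF M]]
  have c: "a \<in> carrier R" using component(1)[OF a] .
  show "?K \<subseteq> carrier R" by auto
  show "\<zero> \<in> ?K" using M'(3) c mult_zero by simp
  fix y assume y: "y \<in> ?K"
  show "y \<oplus> z \<in> ?K" if "z \<in> ?K" for z using y that c M'(4) r_distr by simp
  show "y \<otimes> z \<in> ?K" if "z \<in> carrier R" for z
    using y that c M'(7)[of "a \<otimes> y" z] m_assoc[of a y z] m_closed by auto
  show "\<exists>z\<in>?K. z \<oplus> y = \<zero>"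
    using y c M'(5) mult_minus by (intro bexI[of _ "\<ominus> y"]) (auto simp: l_neg)
  fix \<delta> assume \<delta>: "\<delta> \<in> Mor \<Gamma>"
  show "comp y \<delta> \<in> ?K"
  proof (cases "Dom \<Gamma> \<gamma> = Cod \<Gamma> \<delta>")
    case True
    then show ?thesis
      using y comp_mult_left[OF a \<delta> True, of y] graded_right_idealD(2)[OF M, of "a \<otimes> y" "Comp \<Gamma> \<gamma> \<delta>"] comp_closed
      by simp
  next
    case False
    then have "a \<otimes> comp y \<delta> = \<zero>"
      using mult_not_composable[OF a(1) \<delta> False a(2) comp_in] y \<delta> by simp
    then show ?thesis using y comp_closed M'(3) by simp
  qed
qed

text \<open>If \<open>V\<close> properly contains the transporter, then \<open>aV + M\<close> properly contains \<open>M\<close>, hence is \<open>R\<close>.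
  Writing \<open>a = au + m\<close> with \<open>u \<in> V\<close> and \<open>m \<in> M\<close>, every \<open>y\<close> satisfies \<open>a(y - uy) = my \<in> M\<close>, so
  \<open>y - uy\<close> and with it \<open>y\<close> lie in \<open>V\<close>.\<close>

lemma left_transporter_maximal:
  assumes M: "gr_maximal \<Gamma> R A M" and a: "\<gamma> \<in> Mor \<Gamma>" "a \<in> A \<gamma>"
    and proper: "{y \<in> carrier R. a \<otimes> y \<in> M} \<noteq> carrier R"
  shows "gr_maximal \<Gamma> R A {y \<in> carrier R. a \<otimes> y \<in> M}" (is "gr_maximal \<Gamma> R A ?K")
  unfolding gr_maximal_def
proof (intro conjI allI impI)
  have Mg: "graded_right_ideal \<Gamma> R A M" using M unfolding gr_maximal_def by blast
  note M' = right_idealD[OF graded_right_idealD(1)[OF Mg]]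
  have c: "a \<in> carrier R" using component(1)[OF a] .
  show "graded_right_ideal \<Gamma> R A ?K" by (rule left_transporter_graded[OF Mg a])
  show "?K \<noteq> carrier R" by (rule proper)
  fix V assume V: "graded_right_ideal \<Gamma> R A V \<and> ?K \<subseteq> V"
  then have Vg: "graded_right_ideal \<Gamma> R A V" and KV: "?K \<subseteq> V" by auto
  note V' = right_idealD[OF graded_right_idealD(1)[OF Vg]]
  show "V = ?K \<or> V = carrier R"
  proof (rule disjCI)
    assume "V \<noteq> carrier R"
    show "V = ?K"
    proof (rule ccontr)
      assume "V \<noteq> ?K"
      then obtain v where v: "v \<in> V" "v \<notin> ?K" using KV by blast
      then have av: "a \<otimes> v \<notin> M" using V'(2) by auto
      define P where "P = {a \<otimes> u \<oplus> m | u m. u \<in> V \<and> m \<in> M}"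
      have PI: "a \<otimes> u \<oplus> m \<in> P" if "u \<in> V" "m \<in> M" for u m using that unfolding P_def by blast
      have "graded_right_ideal \<Gamma> R A P"
        unfolding graded_right_ideal_iff right_ideal_def additive_subgroup_iff[OF abelian_group_axioms]
      proof (intro conjI ballI)
        show "P \<subseteq> carrier R" unfolding P_def using V'(2) M'(2) c m_closed by auto
        show "\<zero> \<in> P" using PI[OF V'(3) M'(3)] c mult_zero by simp
      next
        fix w w' assume "w \<in> P" "w' \<in> P"
        then obtain u m u' m' where w: "w = a \<otimes> u \<oplus> m" "w' = a \<otimes> u' \<oplus> m'"
          "u \<in> V" "m \<in> M" "u' \<in> V" "m' \<in> M" unfolding P_def by blast
        then have "w \<oplus> w' = a \<otimes> (u \<oplus> u') \<oplus> (m \<oplus> m')"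
          using V'(2) M'(2) c m_closed r_distr by (simp add: a_ac)
        then show "w \<oplus> w' \<in> P" using PI V'(4) M'(4) w by simp
      next
        fix w assume "w \<in> P"
        then obtain u m where w: "w = a \<otimes> u \<oplus> m" "u \<in> V" "m \<in> M" unfolding P_def by blast
        then have "(a \<otimes> (\<ominus> u) \<oplus> (\<ominus> m)) \<oplus> w = (\<ominus> (a \<otimes> u) \<oplus> a \<otimes> u) \<oplus> (\<ominus> m \<oplus> m)"
          using V'(2) M'(2) c m_closed mult_minus by (simp add: a_ac)
        also have "\<dots> = \<zero>" using V'(2) M'(2) c m_closed w by (simp add: l_neg)
        finally show "\<exists>z\<in>P. z \<oplus> w = \<zero>" using PI V'(5) M'(5) w by blast
      next
        fix w y assume "w \<in> P" and y: "y \<in> carrier R"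
        then obtain u m where w: "w = a \<otimes> u \<oplus> m" "u \<in> V" "m \<in> M" unfolding P_def by blast
        then have "w \<otimes> y = a \<otimes> (u \<otimes> y) \<oplus> m \<otimes> y"
          using V'(2) M'(2) c y m_closed l_distr m_assoc by simp
        then show "w \<otimes> y \<in> P" using PI V'(7) M'(7) w y by simp
      next
        fix w \<epsilon> assume "w \<in> P" and \<epsilon>: "\<epsilon> \<in> Mor \<Gamma>"
        then obtain u m where w: "w = a \<otimes> u \<oplus> m" "u \<in> V" "m \<in> M" unfolding P_def by blast
        have eq: "comp w \<epsilon> = comp (a \<otimes> u) \<epsilon> \<oplus> comp m \<epsilon>"
          using w V'(2) M'(2) c m_closed comp_add by simp
        have m: "comp m \<epsilon> \<in> M" using graded_right_idealD(2)[OF Mg w(3)] .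
        show "comp w \<epsilon> \<in> P"
        proof (rule comp_mult_left_cases[OF a \<epsilon> V'(2)[OF w(2)]])
          assume "comp (a \<otimes> u) \<epsilon> = \<zero>"
          then show ?thesis using eq PI[OF V'(3) m] c mult_zero by simp
        next
          fix \<delta> assume "comp (a \<otimes> u) \<epsilon> = a \<otimes> comp u \<delta>"
          then show ?thesis using eq PI[OF graded_right_idealD(2)[OF Vg w(2)] m] by simp
        qed
      qed
      moreover have "M \<subseteq> P"
      proof
        fix m assume m: "m \<in> M"
        show "m \<in> P" using PI[OF V'(3) m] c mult_zero M'(2)[OF m] by simp
      qed
      moreover have "a \<otimes> v \<in> P"
        using PI[OF v(1) M'(3)] c V'(2)[OF v(1)] m_closed by simp
      ultimately have "P = carrier R" using M av unfolding gr_maximal_def by blast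
      then obtain u m where um: "a = a \<otimes> u \<oplus> m" "u \<in> V" "m \<in> M" using c unfolding P_def by blast
      have "y \<in> V" if y: "y \<in> carrier R" for y
      proof -
        have uc: "u \<in> carrier R" "m \<in> carrier R" using um V'(2) M'(2) by auto
        have "a \<otimes> (y \<ominus> u \<otimes> y) = a \<otimes> y \<ominus> a \<otimes> u \<otimes> y"
          using c y uc m_closed by (simp add: a_minus_def r_distr mult_minus m_assoc)
        also have "a \<otimes> y = a \<otimes> u \<otimes> y \<oplus> m \<otimes> y"
          using um(1) c y uc m_closed l_distr by metis
        also have "(a \<otimes> u \<otimes> y \<oplus> m \<otimes> y) \<ominus> a \<otimes> u \<otimes> y = m \<otimes> y"
          using c y uc m_closed by (simp add: a_minus_def a_comm[of "a \<otimes> u \<otimes> y"] a_assoc r_neg)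
        finally have "a \<otimes> (y \<ominus> u \<otimes> y) \<in> M" using M'(7)[OF um(3) y] by simp
        then have "y \<ominus> u \<otimes> y \<in> V" using KV y uc m_closed by auto
        then have "(y \<ominus> u \<otimes> y) \<oplus> u \<otimes> y \<in> V" using V'(4,7) um(2) y by blast
        then show "y \<in> V" using y uc m_closed by (simp add: a_minus_def a_assoc l_neg)
      qed
      then show False using \<open>V \<noteq> carrier R\<close> V'(2) by blast
    qed
  qed
qed

lemma gr_radical_eq_Inter: "gr_radical \<Gamma> R A = carrier R \<inter> \<Inter>{M. gr_maximal \<Gamma> R A M}"
  unfolding gr_radical_def by blast

lemma gr_radical_graded: "graded_right_ideal \<Gamma> R A (gr_radical \<Gamma> R A)"
  unfolding gr_radical_eq_Inter by (rule graded_right_ideal_Inter) (auto simp: gr_maximal_def)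

text \<open>For homogeneous \<open>a\<close> and gr-maximal \<open>M\<close> the transporter \<open>(M : a)\<close> is \<open>R\<close> or gr-maximal, so it contains the
  radical in either case.\<close>

lemma gr_radical_left_ideal:
  assumes x: "x \<in> carrier R" and y: "y \<in> gr_radical \<Gamma> R A"
  shows "x \<otimes> y \<in> gr_radical \<Gamma> R A"
proof -
  have yc: "y \<in> carrier R" using y unfolding gr_radical_def by simp
  note J' = right_idealD[OF graded_right_idealD(1)[OF gr_radical_graded]]
  from x show ?thesis
  proof (induction rule: homogeneous_induct)
    case zero
    show ?case using yc J'(3) zero_mult by simp
  next
    case (homogeneous \<gamma> a)
    have "a \<otimes> y \<in> M" if M: "gr_maximal \<Gamma> R A M" for M
    proof (cases "{y \<in> carrier R. a \<otimes> y \<in> M} = carrier R")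
      case True
      then show ?thesis using yc by blast
    next
      case False
      then have "gr_maximal \<Gamma> R A {y \<in> carrier R. a \<otimes> y \<in> M}"
        by (rule left_transporter_maximal[OF M homogeneous])
      then show ?thesis using y unfolding gr_radical_def by blast
    qed
    then show ?case using component(1)[OF homogeneous] yc m_closed unfolding gr_radical_def by blast
  next
    case (add u v)
    then show ?case using J'(4) l_distr yc by simp
  qed
qed

text \<open>Semilocality without the quotient ring: a statement about graded right ideals of \<open>R\<close> itself.\<close>

lemma gr_semilocal_iff:
  "gr_semilocal \<Gamma> R A \<longleftrightarrow>
    generated_by_covers (graded_right_ideal \<Gamma> R A) (gr_radical \<Gamma> R A) (carrier R)"
  unfolding gr_semilocal_def Let_def
  by (rule quotient_gr_semisimple_iff[OF gr_radical_graded gr_radical_left_ideal])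

end

section \<open>Corner rings and components as graded rings\<close>

lemma (in nonunital_ring) subring_nonunital_ring:
  assumes C: "additive_subgroup C R" and closed: "\<And>x y. \<lbrakk>x \<in> C; y \<in> C\<rbrakk> \<Longrightarrow> x \<otimes> y \<in> C"
  shows "nonunital_ring (R\<lparr>carrier := C, one := u\<rparr>)"
proof -
  note C' = additive_subgroup_elim[OF C abelian_group_axioms]
  have "abelian_group (R\<lparr>carrier := C, one := u\<rparr>)"
  proof (rule abelian_groupI)
    fix x assume x: "x \<in> carrier (R\<lparr>carrier := C, one := u\<rparr>)"
    show "\<exists>y\<in>carrier (R\<lparr>carrier := C, one := u\<rparr>). y \<oplus>\<^bsub>R\<lparr>carrier := C, one := u\<rparr>\<^esub> x = \<zero>\<^bsub>R\<lparr>carrier := C, one := u\<rparr>\<^esub>"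
      using x C' by (intro bexI[of _ "\<ominus> x"]) (auto simp: l_neg)
  qed (use C' in \<open>auto simp: a_ac\<close>)
  then show ?thesis
    using C' closed m_assoc l_distr r_distr
    by (intro nonunital_ring.intro nonunital_ring_axioms.intro) auto
qed

lemma (in nonunital_ring) subring_additive_subgroup_iff:
  assumes C: "additive_subgroup C R" and closed: "\<And>x y. \<lbrakk>x \<in> C; y \<in> C\<rbrakk> \<Longrightarrow> x \<otimes> y \<in> C"
  shows "additive_subgroup U (R\<lparr>carrier := C, one := u\<rparr>) \<longleftrightarrow> U \<subseteq> C \<and> additive_subgroup U R"
proof -
  have "abelian_group (R\<lparr>carrier := C, one := u\<rparr>)"
    using subring_nonunital_ring[OF C closed] by (rule nonunital_ring.axioms(1))
  then show ?thesis
    using additive_subgroup_elim(1)[OF C abelian_group_axioms]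
    by (auto simp: additive_subgroup_iff additive_subgroup_iff[OF abelian_group_axioms])
qed

lemma (in nonunital_ring) subring_right_ideal_iff:
  assumes C: "additive_subgroup C R" and closed: "\<And>x y. \<lbrakk>x \<in> C; y \<in> C\<rbrakk> \<Longrightarrow> x \<otimes> y \<in> C"
  shows "right_ideal U (R\<lparr>carrier := C, one := u\<rparr>) \<longleftrightarrow>
    U \<subseteq> C \<and> additive_subgroup U R \<and> (\<forall>x\<in>U. \<forall>y\<in>C. x \<otimes> y \<in> U)"
  unfolding right_ideal_def by (simp add: subring_additive_subgroup_iff[OF C closed])

text \<open>The elements supported on a subgroup \<open>H\<close> of the isotropy group at \<open>e\<close> form a ring graded by \<open>H\<close>. The
  two extreme choices are the ones of interest: the trivial subgroup gives \<open>R\<^sub>e\<close>, the whole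
  isotropy group gives the corner ring \<open>1\<^sub>eR1\<^sub>e\<close>.\<close>

lemma (in object_unital_graded_ring) restriction_to_isotropy_subgroup:
  assumes e: "e \<in> Obj \<Gamma>"
    and H: "\<And>\<gamma>. \<gamma> \<in> H \<Longrightarrow> \<gamma> \<in> Mor \<Gamma> \<and> Dom \<Gamma> \<gamma> = e \<and> Cod \<Gamma> \<gamma> = e"
    and H_unit: "e \<in> H"
    and H_Comp: "\<And>\<gamma> \<delta>. \<lbrakk>\<gamma> \<in> H; \<delta> \<in> H\<rbrakk> \<Longrightarrow> Comp \<Gamma> \<gamma> \<delta> \<in> H"
    and H_inverse: "\<And>\<gamma>. \<gamma> \<in> H \<Longrightarrow> \<exists>\<delta>\<in>H. Comp \<Gamma> \<delta> \<gamma> = e \<and> Comp \<Gamma> \<gamma> \<delta> = e"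
    and C: "\<And>x. x \<in> C \<longleftrightarrow> x \<in> carrier R \<and> (\<forall>\<gamma>\<in>Mor \<Gamma>. \<gamma> \<notin> H \<longrightarrow> comp x \<gamma> = \<zero>)"
  shows "object_unital_graded_ring (\<Gamma>\<lparr>Mor := H, Obj := {e}\<rparr>) (R\<lparr>carrier := C, one := u\<rparr>) A"
proof -
  let ?\<Gamma> = "\<Gamma>\<lparr>Mor := H, Obj := {e}\<rparr>" and ?S = "R\<lparr>carrier := C, one := u\<rparr>"
  have AC: "A \<gamma> \<subseteq> C" if "\<gamma> \<in> H" for \<gamma>
  proof
    fix a assume a: "a \<in> A \<gamma>"
    then show "a \<in> C" unfolding C using that H component(1) comp_homogeneous[OF a] by auto
  qed
  have Csub: "additive_subgroup C R"
    unfolding additive_subgroup_iff[OF abelian_group_axioms]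
  proof (intro conjI ballI)
    fix x assume "x \<in> C"
    then show "\<exists>y\<in>C. y \<oplus> x = \<zero>"
      using minus_equality[of \<zero> \<zero>] by (intro bexI[of _ "\<ominus> x"]) (auto simp: C comp_minus l_neg)
  qed (auto simp: C comp_zero comp_add)
  note C' = additive_subgroup_elim[OF Csub abelian_group_axioms]
  have C_induct: "x \<in> T" if "x \<in> C" "\<zero> \<in> T" "\<And>\<gamma>. \<gamma> \<in> H \<Longrightarrow> A \<gamma> \<subseteq> T"
    "\<And>y z. \<lbrakk>y \<in> carrier R; z \<in> carrier R; y \<in> T; z \<in> T\<rbrakk> \<Longrightarrow> y \<oplus> z \<in> T" for x T
  proof (rule in_if_components_in[OF C'(1)[OF that(1)] that(2,4)])
    fix \<gamma> assume \<gamma>: "\<gamma> \<in> Mor \<Gamma>"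
    show "comp x \<gamma> \<in> T"
    proof (cases "\<gamma> \<in> H")
      case True
      then show ?thesis using that(3) comp_in[OF C'(1)[OF that(1)] \<gamma>] by blast
    next
      case False
      then show ?thesis using that(1,2) \<gamma> unfolding C by auto
    qed
  qed
  have closed: "x \<otimes> y \<in> C" if x: "x \<in> C" and y: "y \<in> C" for x y
  proof -
    have hom: "a \<otimes> y \<in> C" if \<gamma>: "\<gamma> \<in> H" and a: "a \<in> A \<gamma>" for a \<gamma>
    proof -
      have ac: "a \<in> carrier R" using AC \<gamma> a C'(1) by blast
      have "y \<in> {y \<in> carrier R. a \<otimes> y \<in> C}"
      proof (rule C_induct[OF y])
        fix \<delta> assume \<delta>: "\<delta> \<in> H"
        have "a \<otimes> b \<in> C" if b: "b \<in> A \<delta>" for b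
          using mult_composable[of \<gamma> \<delta> a b] a b H \<gamma> \<delta> AC[OF H_Comp[OF \<gamma> \<delta>]] by auto
        then show "A \<delta> \<subseteq> {y \<in> carrier R. a \<otimes> y \<in> C}" using AC[OF \<delta>] C'(1) by blast
      qed (use ac C'(2,3) mult_zero r_distr in auto)
      then show ?thesis by simp
    qed
    have "x \<in> {x \<in> carrier R. x \<otimes> y \<in> C}"
    proof (rule C_induct[OF x])
      show "A \<gamma> \<subseteq> {x \<in> carrier R. x \<otimes> y \<in> C}" if "\<gamma> \<in> H" for \<gamma>
        using hom AC C'(1) that by blast
    qed (use C' y zero_mult l_distr in auto)
    then show ?thesis by simp
  qed
  interpret S: nonunital_ring ?S by (rule subring_nonunital_ring[OF Csub closed])
  show ?thesis
  proof (intro object_unital_graded_ring.intro object_unital_graded_ring_axioms.intro groupoid.intro)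
    show "nonunital_ring ?S" by (rule S.nonunital_ring_axioms)
    show sub: "additive_subgroup (A \<gamma>) ?S" if "\<gamma> \<in> Mor ?\<Gamma>" for \<gamma>
      using that AC H component_subgroup by (simp add: subring_additive_subgroup_iff[OF Csub closed])
    show "internal_direct_sum ?S (Mor ?\<Gamma>) A (carrier ?S)"
    proof (rule S.internal_direct_sumI[where p = "\<lambda>\<gamma> x. comp x \<gamma>"])
      show "additive_subgroup (carrier ?S) ?S" using S.carrier_right_ideal unfolding right_ideal_def by blast
      fix x assume x: "x \<in> carrier ?S"
      then have xc: "x \<in> carrier R" using C'(1) by simp
      have "{\<gamma> \<in> H. comp x \<gamma> \<noteq> \<zero>} \<subseteq> {\<gamma>. comp x \<gamma> \<noteq> \<zero>}" by auto
      then show "finite {\<gamma> \<in> Mor ?\<Gamma>. comp x \<gamma> \<noteq> \<zero>\<^bsub>?S\<^esub>}"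
        using finite_subset[OF _ comp_finite[OF xc]] by simp
      assume "\<And>\<gamma>. \<gamma> \<in> Mor ?\<Gamma> \<Longrightarrow> comp x \<gamma> = \<zero>\<^bsub>?S\<^esub>"
      then have "comp x \<gamma> = \<zero>" if "\<gamma> \<in> Mor \<Gamma>" for \<gamma>
        using x that by (cases "\<gamma> \<in> H") (auto simp: C)
      then show "x = \<zero>\<^bsub>?S\<^esub>" using zero_if_components_zero[OF xc] by simp
    next
      fix \<gamma> \<delta> b assume *: "\<gamma> \<in> Mor ?\<Gamma>" "b \<in> A \<gamma>"
      show "comp b \<gamma> = b" using * H comp_homogeneous[of b \<gamma> \<gamma>] by simp
      show "comp b \<delta> = \<zero>\<^bsub>?S\<^esub>" if "\<gamma> \<noteq> \<delta>" using * H comp_homogeneous[of b \<gamma> \<delta>] that by simp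
    qed (use AC H comp_in C'(1) comp_add in auto)
    show "\<exists>u\<in>A f. \<forall>a\<in>A f. u \<otimes>\<^bsub>?S\<^esub> a = a \<and> a \<otimes>\<^bsub>?S\<^esub> u = a" if "f \<in> Obj ?\<Gamma>" for f
      using that unit_ex[OF e] by simp
    show "unit_of ?S (A (Cod ?\<Gamma> \<gamma>)) \<otimes>\<^bsub>?S\<^esub> a = a" if "\<gamma> \<in> Mor ?\<Gamma>" "a \<in> A \<gamma>" for \<gamma> a
      using that H unit_left[of \<gamma> a] by (simp add: unit_of_def)
    show "a \<otimes>\<^bsub>?S\<^esub> unit_of ?S (A (Dom ?\<Gamma> \<gamma>)) = a" if "\<gamma> \<in> Mor ?\<Gamma>" "a \<in> A \<gamma>" for \<gamma> a
      using that H unit_right[of \<gamma> a] by (simp add: unit_of_def)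
    show "\<exists>\<delta>\<in>Mor ?\<Gamma>. Dom ?\<Gamma> \<delta> = Cod ?\<Gamma> \<gamma> \<and> Cod ?\<Gamma> \<delta> = Dom ?\<Gamma> \<gamma> \<and>
      Comp ?\<Gamma> \<delta> \<gamma> = Dom ?\<Gamma> \<gamma> \<and> Comp ?\<Gamma> \<gamma> \<delta> = Cod ?\<Gamma> \<gamma>" if "\<gamma> \<in> Mor ?\<Gamma>" for \<gamma>
      using that H H_inverse[of \<gamma>] by auto
    show "a \<otimes>\<^bsub>?S\<^esub> b \<in> A (Comp ?\<Gamma> \<gamma> \<delta>)"
      if "\<gamma> \<in> Mor ?\<Gamma>" "\<delta> \<in> Mor ?\<Gamma>" "a \<in> A \<gamma>" "b \<in> A \<delta>" for \<gamma> \<delta> a b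
      using that H mult_composable[of \<gamma> \<delta> a b] by simp
    show "Comp ?\<Gamma> (Comp ?\<Gamma> \<epsilon> \<delta>) \<gamma> = Comp ?\<Gamma> \<epsilon> (Comp ?\<Gamma> \<delta> \<gamma>)"
      if "\<epsilon> \<in> Mor ?\<Gamma>" "\<delta> \<in> Mor ?\<Gamma>" "\<gamma> \<in> Mor ?\<Gamma>" for \<epsilon> \<delta> \<gamma>
      using that H Comp_assoc[of \<epsilon> \<delta> \<gamma>] by simp
    show "Comp ?\<Gamma> \<gamma> (Dom ?\<Gamma> \<gamma>) = \<gamma>" "Comp ?\<Gamma> (Cod ?\<Gamma> \<gamma>) \<gamma> = \<gamma>" if "\<gamma> \<in> Mor ?\<Gamma>" for \<gamma>
      using that H Comp_Dom[of \<gamma>] Cod_Comp_left[of \<gamma>] by simp_all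
  qed (use H H_unit H_Comp Dom_Obj[OF e] Cod_Obj[OF e] in auto)
qed

text \<open>With a single degree every right ideal is graded, so the graded notions specialise to the
  ungraded ones.\<close>

lemma trivially_graded_right_ideal_iff:
  assumes R: "abelian_group R" and M: "Mor \<Gamma> = {e}" and A: "A e = carrier R"
  shows "graded_right_ideal \<Gamma> R A U \<longleftrightarrow> right_ideal U R"
proof -
  interpret abelian_group R by fact
  have "internal_direct_sum R (Mor \<Gamma>) (\<lambda>\<gamma>. U \<inter> A \<gamma>) U" if "additive_subgroup U R"
    by (rule internal_direct_sumI[where p = "\<lambda>_ x. x", OF that])
      (use additive_subgroup.a_subset[OF that] M A in auto)
  then show ?thesis unfolding graded_right_ideal_def right_ideal_def by blast
qed

lemma (in object_unital_graded_ring) trivially_graded_semilocal_iff: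
  assumes M: "Mor \<Gamma> = {e}" and A: "A e = carrier R"
  shows "semilocal_ring R \<longleftrightarrow> gr_semilocal \<Gamma> R A"
    and "gr_radical \<Gamma> R A = jacobson_radical R"
proof -
  let ?J = "gr_radical \<Gamma> R A"
  note iff = trivially_graded_right_ideal_iff[where A = A, OF abelian_group_axioms M A]
  show J: "?J = jacobson_radical R"
    unfolding gr_radical_def jacobson_radical_def gr_maximal_def maximal_right_ideal_def iff ..
  have Q: "abelian_group (R Quot ?J)"
    by (rule quotient_abelian_group[OF gr_radical_graded gr_radical_left_ideal])
  have "quotient_grading R ?J A e = carrier (R Quot ?J)"
    by (simp add: quotient_grading_def quotient_carrier[OF gr_radical_graded gr_radical_left_ideal] A)
  note iffQ = trivially_graded_right_ideal_iff[where A = "quotient_grading R ?J A", OF Q M this]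
  show "semilocal_ring R \<longleftrightarrow> gr_semilocal \<Gamma> R A"
    unfolding semilocal_ring_def gr_semilocal_def Let_def J[symmetric] semisimple_ring_def
      gr_semisimple_def gr_simple_def simple_right_ideal_def iffQ ..
qed

context object_unital_graded_ring
begin

lemma component_ring_graded:
  assumes e: "e \<in> Obj \<Gamma>"
  shows "object_unital_graded_ring (\<Gamma>\<lparr>Mor := {e}, Obj := {e}\<rparr>) (component_ring R A e) A"
  unfolding component_ring_def
proof (rule restriction_to_isotropy_subgroup[OF e])
  note eM = Obj_Mor[OF e]
  show "x \<in> A e \<longleftrightarrow> x \<in> carrier R \<and> (\<forall>\<gamma>\<in>Mor \<Gamma>. \<gamma> \<notin> {e} \<longrightarrow> comp x \<gamma> = \<zero>)" for x
  proof
    assume x: "x \<in> A e"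
    show "x \<in> carrier R \<and> (\<forall>\<gamma>\<in>Mor \<Gamma>. \<gamma> \<notin> {e} \<longrightarrow> comp x \<gamma> = \<zero>)"
      using component(1)[OF eM x] comp_homogeneous[OF x eM] by simp
  next
    assume x: "x \<in> carrier R \<and> (\<forall>\<gamma>\<in>Mor \<Gamma>. \<gamma> \<notin> {e} \<longrightarrow> comp x \<gamma> = \<zero>)"
    show "x \<in> A e"
    proof (rule in_subgroup_if_components_in[OF component_subgroup[OF eM]])
      show "comp x \<gamma> \<in> A e" if "\<gamma> \<in> Mor \<Gamma>" for \<gamma>
        using x that comp_in[of x \<gamma>] component(2)[OF eM] by (cases "\<gamma> = e") auto
    qed (use x in simp)
  qed
qed (use e Dom_Obj Cod_Obj Obj_Mor Comp_Obj in auto)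

lemma component_semilocal_iff:
  assumes e: "e \<in> Obj \<Gamma>"
  shows "semilocal_ring (component_ring R A e) \<longleftrightarrow>
    generated_by_covers (\<lambda>N. right_ideal N (component_ring R A e))
      (jacobson_radical (component_ring R A e)) (A e)"
proof -
  let ?\<Gamma> = "\<Gamma>\<lparr>Mor := {e}, Obj := {e}\<rparr>"
  interpret S: object_unital_graded_ring ?\<Gamma> "component_ring R A e" A
    by (rule component_ring_graded[OF e])
  have M: "Mor ?\<Gamma> = {e}" and A: "A e = carrier (component_ring R A e)"
    by (simp_all add: component_ring_def)
  have "graded_right_ideal ?\<Gamma> (component_ring R A e) A = (\<lambda>N. right_ideal N (component_ring R A e))"
    using trivially_graded_right_ideal_iff[where A = A, OF S.abelian_group_axioms M A] by blast
  then show ?thesis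
    using S.trivially_graded_semilocal_iff[OF M A] S.gr_semilocal_iff A by simp
qed

lemma component_right_ideal_iff:
  assumes e: "e \<in> Obj \<Gamma>"
  shows "right_ideal N (component_ring R A e) \<longleftrightarrow>
    N \<subseteq> A e \<and> additive_subgroup N R \<and> (\<forall>x\<in>N. \<forall>y\<in>A e. x \<otimes> y \<in> N)"
  unfolding component_ring_def
proof (rule subring_right_ideal_iff)
  show "additive_subgroup (A e) R" using component_subgroup Obj_Mor[OF e] .
  show "x \<otimes> y \<in> A e" if "x \<in> A e" "y \<in> A e" for x y
    using mult_composable[of e e x y] that Obj_Mor[OF e] Dom_Obj[OF e] Cod_Obj[OF e] Comp_Obj[OF e] by simp
qed

text \<open>Multiplying a homogeneous element by the local unit at \<open>e\<close> on both sides keeps it or kills it,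
  according to whether its degree lies in the isotropy group at \<open>e\<close>. So the corner consists of the
  elements supported there.\<close>

lemma corner_ring_graded:
  assumes e: "e \<in> Obj \<Gamma>"
  shows "object_unital_graded_ring (vertex_group \<Gamma> e) (corner_ring R A e) A"
  unfolding vertex_group_def corner_ring_def
proof (rule restriction_to_isotropy_subgroup[OF e])
  let ?H = "{\<gamma> \<in> Mor \<Gamma>. Dom \<Gamma> \<gamma> = e \<and> Cod \<Gamma> \<gamma> = e}"
  let ?u = "local_unit e"
  note eM = Obj_Mor[OF e]
  have u: "?u \<in> A e" "?u \<in> carrier R" using local_unit(1)[OF e] component(1)[OF eM] by auto
  show "\<exists>\<delta>\<in>?H. Comp \<Gamma> \<delta> \<gamma> = e \<and> Comp \<Gamma> \<gamma> \<delta> = e" if "\<gamma> \<in> ?H" for \<gamma>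
    using inverse_ex[of \<gamma>] that by auto
  have cut: "?u \<otimes> a \<otimes> ?u = (if \<gamma> \<in> ?H then a else \<zero>)" if \<gamma>: "\<gamma> \<in> Mor \<Gamma>" and a: "a \<in> A \<gamma>" for \<gamma> a
  proof -
    have l: "?u \<otimes> a = (if Cod \<Gamma> \<gamma> = e then a else \<zero>)"
      using unit_left[OF \<gamma> a] mult_not_composable[OF eM \<gamma> _ u(1) a] Dom_Obj[OF e] by auto
    have r: "a \<otimes> ?u = (if Dom \<Gamma> \<gamma> = e then a else \<zero>)"
      using unit_right[OF \<gamma> a] mult_not_composable[OF \<gamma> eM _ a u(1)] Cod_Obj[OF e] by auto
    show ?thesis using l r zero_mult[OF u(2)] \<gamma> by simp
  qed
  have cut_zero: "?u \<otimes> \<zero> \<otimes> ?u = \<zero>" using u(2) by (simp add: mult_zero zero_mult)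
  have cut_add: "?u \<otimes> (y \<oplus> z) \<otimes> ?u = ?u \<otimes> y \<otimes> ?u \<oplus> ?u \<otimes> z \<otimes> ?u"
    if "y \<in> carrier R" "z \<in> carrier R" for y z using that u(2) by (simp add: r_distr l_distr m_closed)
  show "x \<in> {?u \<otimes> x \<otimes> ?u | x. x \<in> carrier R} \<longleftrightarrow>
      x \<in> carrier R \<and> (\<forall>\<gamma>\<in>Mor \<Gamma>. \<gamma> \<notin> ?H \<longrightarrow> comp x \<gamma> = \<zero>)" for x
  proof
    assume "x \<in> {?u \<otimes> x \<otimes> ?u | x. x \<in> carrier R}"
    then obtain y where x: "x = ?u \<otimes> y \<otimes> ?u" and y: "y \<in> carrier R" by blast
    have "comp (?u \<otimes> y \<otimes> ?u) \<gamma> = \<zero>" if \<gamma>: "\<gamma> \<in> Mor \<Gamma>" "\<gamma> \<notin> ?H" for \<gamma>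
      using y
    proof (induction rule: homogeneous_induct)
      case (homogeneous \<delta> a)
      have "comp (if \<delta> \<in> ?H then a else \<zero>) \<gamma> = \<zero>"
        using comp_homogeneous[OF homogeneous(2,1), of \<gamma>] \<gamma> comp_zero by auto
      then show ?case unfolding cut[OF homogeneous] .
    qed (use u(2) in \<open>simp_all add: cut_zero cut_add comp_zero comp_add m_closed\<close>)
    then show "x \<in> carrier R \<and> (\<forall>\<gamma>\<in>Mor \<Gamma>. \<gamma> \<notin> ?H \<longrightarrow> comp x \<gamma> = \<zero>)"
      using x y u(2) m_closed by simp
  next
    assume x: "x \<in> carrier R \<and> (\<forall>\<gamma>\<in>Mor \<Gamma>. \<gamma> \<notin> ?H \<longrightarrow> comp x \<gamma> = \<zero>)"
    have "x \<in> {x. ?u \<otimes> x \<otimes> ?u = x}"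
    proof (rule in_if_components_in)
      show "comp x \<gamma> \<in> {x. ?u \<otimes> x \<otimes> ?u = x}" if "\<gamma> \<in> Mor \<Gamma>" for \<gamma>
        using cut[OF that comp_in[OF _ that]] x that by auto
    qed (use x in \<open>simp_all add: cut_zero cut_add\<close>)
    then have "x = ?u \<otimes> x \<otimes> ?u" by simp
    then show "x \<in> {?u \<otimes> x \<otimes> ?u | x. x \<in> carrier R}" using x by blast
  qed
qed (use e Dom_Obj Cod_Obj Obj_Mor Comp_in Dom_Comp Cod_Comp in auto)

lemma component_ring_corner_ring:
  "component_ring (corner_ring R A e) A e = component_ring R A e"
  by (simp add: component_ring_def corner_ring_def unit_of_def)

end

section \<open>Right ideals of a component and graded right ideals\<close>

context object_unital_graded_ring
begin

text \<open>On a homogeneous \<open>x\<close> of degree \<open>\<gamma>\<close> the condition is void if the codomain of \<open>\<gamma>\<close> is not \<open>e\<close>, and otherwise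
  says that \<open>xy \<in> N\<close> for all \<open>y\<close> of degree \<open>\<gamma>\<inverse>\<close>. Stated with arbitrary \<open>y\<close> it defines a right ideal by
  associativity alone.\<close>

definition extension :: "'g \<Rightarrow> 'a set \<Rightarrow> 'a set"
  where "extension e N = {x \<in> carrier R. \<forall>y\<in>carrier R. comp (x \<otimes> y) e \<in> N}"

context
  fixes e
  assumes e: "e \<in> Obj \<Gamma>"
begin

lemmas e_Mor = Obj_Mor[OF e]

lemma trace_right_ideal:
  assumes U: "right_ideal U R"
  shows "right_ideal (U \<inter> A e) (component_ring R A e)"
  unfolding component_right_ideal_iff[OF e] additive_subgroup_iff[OF abelian_group_axioms]
proof (intro conjI ballI)
  note U' = right_idealD[OF U] and A' = component[OF e_Mor]
  show "U \<inter> A e \<subseteq> carrier R" using A'(1) by blast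
  show "\<zero> \<in> U \<inter> A e" using U'(3) A'(2) by blast
  fix x assume x: "x \<in> U \<inter> A e"
  show "x \<oplus> y \<in> U \<inter> A e" if "y \<in> U \<inter> A e" for y using x that U'(4) A'(3) by blast
  show "x \<otimes> y \<in> U \<inter> A e" if "y \<in> A e" for y
    using x that U'(7) A'(1) mult_composable[OF e_Mor e_Mor] Dom_Obj[OF e] Cod_Obj[OF e] Comp_Obj[OF e]
    by auto
  show "\<exists>y\<in>U \<inter> A e. y \<oplus> x = \<zero>"
    using x U'(2,5) A'(4) by (intro bexI[of _ "\<ominus> x"]) (auto simp: l_neg)
qed auto

context
  fixes N
  assumes N: "right_ideal N (component_ring R A e)"
begin

lemmas N_ideal =
  component_right_ideal_iff[OF e, THEN iffD1, OF N, THEN conjunct1]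
  component_right_ideal_iff[OF e, THEN iffD1, OF N, THEN conjunct2, THEN conjunct1]
  component_right_ideal_iff[OF e, THEN iffD1, OF N, THEN conjunct2, THEN conjunct2, rule_format]

lemmas N_subgroup = additive_subgroup_elim[OF N_ideal(2) abelian_group_axioms]

text \<open>For the components of \<open>x\<close>: if \<open>\<gamma>\<delta> = e\<close>, the product of the components \<open>x\<^sub>\<gamma>\<close> and \<open>y\<^sub>\<delta>\<close> is the component of
  degree \<open>e\<close> both of \<open>x\<^sub>\<gamma>y\<close> and of \<open>xy\<^sub>\<delta>\<close>.\<close>

lemma extension_graded: "graded_right_ideal \<Gamma> R A (extension e N)"
  unfolding graded_right_ideal_iff right_ideal_def additive_subgroup_iff[OF abelian_group_axioms]
proof (intro conjI ballI)
  show "extension e N \<subseteq> carrier R" unfolding extension_def by blast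
  show "\<zero> \<in> extension e N" using N_subgroup(2) unfolding extension_def by (simp add: zero_mult comp_zero)
  fix x assume x: "x \<in> extension e N"
  then have xc: "x \<in> carrier R" and xN: "\<And>y. y \<in> carrier R \<Longrightarrow> comp (x \<otimes> y) e \<in> N"
    unfolding extension_def by auto
  show "x \<oplus> z \<in> extension e N" if "z \<in> extension e N" for z
    using xc xN that N_subgroup(3) unfolding extension_def by (simp add: l_distr comp_add m_closed)
  show "x \<otimes> z \<in> extension e N" if "z \<in> carrier R" for z
    using xc xN that unfolding extension_def by (simp add: m_assoc m_closed)
  show "\<exists>z\<in>extension e N. z \<oplus> x = \<zero>"
    using xc xN N_subgroup(4) unfolding extension_def
    by (intro bexI[of _ "\<ominus> x"]) (auto simp: minus_mult comp_minus m_closed l_neg)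
  fix \<gamma> assume \<gamma>: "\<gamma> \<in> Mor \<Gamma>"
  have "comp (comp x \<gamma> \<otimes> y) e \<in> N" if y: "y \<in> carrier R" for y
  proof (rule comp_mult_left_cases[OF \<gamma> comp_in[OF xc \<gamma>] e_Mor y])
    assume "comp (comp x \<gamma> \<otimes> y) e = \<zero>"
    then show ?thesis using N_subgroup(2) by simp
  next
    fix \<delta> assume \<delta>: "\<delta> \<in> Mor \<Gamma>" "Dom \<Gamma> \<gamma> = Cod \<Gamma> \<delta>" "Comp \<Gamma> \<gamma> \<delta> = e"
      "comp (comp x \<gamma> \<otimes> y) e = comp x \<gamma> \<otimes> comp y \<delta>"
    have "comp (x \<otimes> comp y \<delta>) e = comp x \<gamma> \<otimes> comp y \<delta>"
      using comp_mult_right[OF \<delta>(1) comp_in[OF y \<delta>(1)] \<gamma> \<delta>(2) xc] \<delta>(3) by simp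
    then show ?thesis using \<delta>(4) xN[OF comp_closed[OF y]] by metis
  qed
  then show "comp x \<gamma> \<in> extension e N" unfolding extension_def using comp_closed[OF xc] by simp
qed

lemma extension_trace: "extension e N \<inter> A e = N"
proof -
  have comp: "comp (x \<otimes> y) e = x \<otimes> comp y e" if "x \<in> A e" "y \<in> carrier R" for x y
    using comp_mult_left[OF e_Mor that(1) e_Mor _ that(2)] Dom_Obj[OF e] Cod_Obj[OF e] Comp_Obj[OF e] by simp
  show ?thesis
  proof (intro equalityI subsetI)
    fix x assume "x \<in> extension e N \<inter> A e"
    then have x: "x \<in> A e" "\<And>y. y \<in> carrier R \<Longrightarrow> comp (x \<otimes> y) e \<in> N" unfolding extension_def by auto
    have "local_unit e \<in> carrier R" using local_unit(1)[OF e] component(1)[OF e_Mor] by blast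
    then have "comp (x \<otimes> local_unit e) e \<in> N" by (rule x(2))
    then show "x \<in> N" using local_unit(3)[OF e x(1)] comp_homogeneous[OF x(1) e_Mor, of e] by simp
  next
    fix x assume x: "x \<in> N"
    then have "x \<in> A e" using N_ideal(1) by blast
    then show "x \<in> extension e N \<inter> A e"
      using x comp N_ideal(3) comp_in[OF _ e_Mor] component(1)[OF e_Mor] unfolding extension_def by simp
  qed
qed

lemma extension_other: "\<lbrakk>f \<in> Obj \<Gamma>; f \<noteq> e\<rbrakk> \<Longrightarrow> A f \<subseteq> extension e N"
  using comp_mult_left_other[OF Obj_Mor, of f _ e] Cod_Obj[of f] Cod_Obj[OF e] N_subgroup(2)
    component(1)[OF Obj_Mor, of f]
  unfolding extension_def by auto

text \<open>The adjunction between trace and extension. If \<open>x \<in> U\<close>, then \<open>xy\<close> and its component of degree \<open>e\<close>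
  also lie in \<open>U\<close>.\<close>

lemma subset_extension_iff:
  assumes U: "graded_right_ideal \<Gamma> R A U"
  shows "U \<subseteq> extension e N \<longleftrightarrow> U \<inter> A e \<subseteq> N"
proof
  assume "U \<subseteq> extension e N"
  then show "U \<inter> A e \<subseteq> N" using extension_trace by blast
next
  note U' = right_idealD[OF graded_right_idealD(1)[OF U]]
  assume sub: "U \<inter> A e \<subseteq> N"
  show "U \<subseteq> extension e N"
  proof
    fix x assume x: "x \<in> U"
    have "comp (x \<otimes> y) e \<in> N" if y: "y \<in> carrier R" for y
      using sub graded_right_idealD(2)[OF U U'(7)[OF x y], of e] comp_in[OF m_closed[OF U'(2)[OF x] y] e_Mor]
      by blast
    then show "x \<in> extension e N" unfolding extension_def using U'(2)[OF x] by simp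
  qed
qed

lemma extension_eq_carrier_iff: "extension e N = carrier R \<longleftrightarrow> N = A e"
proof
  assume "extension e N = carrier R"
  then show "N = A e" using extension_trace component(1)[OF e_Mor] by blast
next
  assume "N = A e"
  then have "carrier R \<subseteq> extension e N" using subset_extension_iff[OF carrier_graded] by simp
  then show "extension e N = carrier R" unfolding extension_def by blast
qed

end

end

text \<open>The local units generate \<open>R\<close> as a right ideal, because a homogeneous element is unchanged by the local
  unit at the codomain of its degree, acting from the left.\<close>

lemma carrier_if_contains_components:
  assumes U: "right_ideal U R" and A: "\<And>e. e \<in> Obj \<Gamma> \<Longrightarrow> A e \<subseteq> U"
  shows "U = carrier R"
proof (intro equalityI subsetI)
  note U' = right_idealD[OF U]
  show "x \<in> carrier R" if "x \<in> U" for x using U'(2) that .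
  fix x assume x: "x \<in> carrier R"
  show "x \<in> U"
  proof (rule in_subgroup_if_components_in[OF U'(1) x])
    fix \<gamma> assume \<gamma>: "\<gamma> \<in> Mor \<Gamma>"
    have "local_unit (Cod \<Gamma> \<gamma>) \<in> U" using A local_unit(1) Cod_in[OF \<gamma>] by blast
    then have "local_unit (Cod \<Gamma> \<gamma>) \<otimes> comp x \<gamma> \<in> U" using U'(7) comp_closed[OF x] by blast
    then show "comp x \<gamma> \<in> U" using unit_left[OF \<gamma> comp_in[OF x \<gamma>]] by simp
  qed
qed

text \<open>A graded right ideal above \<open>extension e N\<close> already contains \<open>R\<^sub>f\<close> for \<open>f \<noteq> e\<close>, so only its trace on
  \<open>R\<^sub>e\<close> is in question, and for this the maximality of \<open>N\<close> leaves two possibilities.\<close>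

lemma extension_gr_maximal:
  assumes e: "e \<in> Obj \<Gamma>" and N: "maximal_right_ideal N (component_ring R A e)"
  shows "gr_maximal \<Gamma> R A (extension e N)"
proof -
  have Nr: "right_ideal N (component_ring R A e)" and proper: "N \<noteq> A e"
    and max: "\<And>V. \<lbrakk>right_ideal V (component_ring R A e); N \<subseteq> V\<rbrakk> \<Longrightarrow> V = N \<or> V = A e"
    using N unfolding maximal_right_ideal_def by (auto simp: component_ring_def)
  show ?thesis
    unfolding gr_maximal_def
  proof (intro conjI allI impI extension_graded[OF e Nr])
    show "extension e N \<noteq> carrier R" using extension_eq_carrier_iff[OF e Nr] proper by simp
    fix V assume V: "graded_right_ideal \<Gamma> R A V \<and> extension e N \<subseteq> V"
    then have Vr: "right_ideal V R" using graded_right_idealD(1) by blast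
    have "N \<subseteq> V \<inter> A e" using V extension_trace[OF e Nr] by blast
    then consider "V \<inter> A e = N" | "V \<inter> A e = A e" using max[OF trace_right_ideal[OF e Vr]] by blast
    then show "V = extension e N \<or> V = carrier R"
    proof cases
      case 1
      then have "V \<subseteq> extension e N" using subset_extension_iff[OF e Nr] V by simp
      then show ?thesis using V by blast
    next
      case 2
      have "A f \<subseteq> V" if "f \<in> Obj \<Gamma>" for f
        using 2 V extension_other[OF e Nr that] by (cases "f = e") auto
      then show ?thesis using carrier_if_contains_components[OF Vr] by blast
    qed
  qed
qed

text \<open>\<open>M\<close> misses part of some \<open>R\<^sub>e\<close>. Every proper right ideal \<open>N\<close> of \<open>R\<^sub>e\<close> above the trace of \<open>M\<close> has a
  proper extension containing \<open>M\<close>, which is therefore \<open>M\<close>; taking traces, \<open>N\<close> is the trace of \<open>M\<close>.\<close>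

lemma gr_maximal_is_extension:
  assumes M: "gr_maximal \<Gamma> R A M"
  obtains e where "e \<in> Obj \<Gamma>" "maximal_right_ideal (M \<inter> A e) (component_ring R A e)"
    "M = extension e (M \<inter> A e)"
proof -
  have Mg: "graded_right_ideal \<Gamma> R A M" and proper: "M \<noteq> carrier R"
    and max: "\<And>V. \<lbrakk>graded_right_ideal \<Gamma> R A V; M \<subseteq> V\<rbrakk> \<Longrightarrow> V = M \<or> V = carrier R"
    using M unfolding gr_maximal_def by auto
  note Mr = graded_right_idealD(1)[OF Mg]
  obtain e where e: "e \<in> Obj \<Gamma>" and ne: "M \<inter> A e \<noteq> A e"
    using carrier_if_contains_components[OF Mr] proper by blast
  have ext: "extension e N = M"
    if N: "right_ideal N (component_ring R A e)" "M \<inter> A e \<subseteq> N" "N \<noteq> A e" for N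
    using max[OF extension_graded[OF e N(1)]] subset_extension_iff[OF e N(1) Mg] N(2,3)
      extension_eq_carrier_iff[OF e N(1)] by blast
  note trace = trace_right_ideal[OF e Mr]
  have "maximal_right_ideal (M \<inter> A e) (component_ring R A e)"
    unfolding maximal_right_ideal_def
  proof (intro conjI allI impI trace)
    show "M \<inter> A e \<noteq> carrier (component_ring R A e)" using ne by (simp add: component_ring_def)
    fix V assume V: "right_ideal V (component_ring R A e) \<and> M \<inter> A e \<subseteq> V"
    show "V = M \<inter> A e \<or> V = carrier (component_ring R A e)"
    proof (cases "V = A e")
      case True
      then show ?thesis by (simp add: component_ring_def)
    next
      case False
      then have "extension e V = M" using ext V by blast
      then show ?thesis using extension_trace[OF e, of V] V by blast
    qed
  qed
  then show ?thesis using that[OF e] ext[OF trace subset_refl ne] by simp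
qed

lemma gr_radical_trace:
  assumes e: "e \<in> Obj \<Gamma>"
  shows "gr_radical \<Gamma> R A \<inter> A e = jacobson_radical (component_ring R A e)"
proof (intro equalityI subsetI)
  fix x assume x: "x \<in> gr_radical \<Gamma> R A \<inter> A e"
  have "x \<in> N" if N: "maximal_right_ideal N (component_ring R A e)" for N
  proof -
    have "x \<in> extension e N" using x extension_gr_maximal[OF e N] unfolding gr_radical_def by blast
    then show ?thesis using x extension_trace[OF e, of N] N unfolding maximal_right_ideal_def by blast
  qed
  then show "x \<in> jacobson_radical (component_ring R A e)"
    using x unfolding jacobson_radical_def by (simp add: component_ring_def)
next
  fix x assume "x \<in> jacobson_radical (component_ring R A e)"
  then have x: "x \<in> A e" "\<And>N. maximal_right_ideal N (component_ring R A e) \<Longrightarrow> x \<in> N"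
    unfolding jacobson_radical_def by (simp_all add: component_ring_def)
  have "x \<in> M" if M: "gr_maximal \<Gamma> R A M" for M
  proof (rule gr_maximal_is_extension[OF M])
    fix f assume f: "f \<in> Obj \<Gamma>" "maximal_right_ideal (M \<inter> A f) (component_ring R A f)"
      "M = extension f (M \<inter> A f)"
    show "x \<in> M"
    proof (cases "f = e")
      case True
      then show ?thesis using f(2) x(2) by blast
    next
      case False
      have "A e \<subseteq> extension f (M \<inter> A f)"
        using extension_other[OF f(1) _ e] f(2) False unfolding maximal_right_ideal_def by blast
      then show ?thesis using x(1) f(3) by blast
    qed
  qed
  then show "x \<in> gr_radical \<Gamma> R A \<inter> A e"
    using x(1) component(1)[OF Obj_Mor[OF e]] unfolding gr_radical_def by blast
qed

text \<open>Each gr-maximal right ideal is an extension, and by the adjunction containment in an extension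
  is tested on traces.\<close>

lemma subset_gr_radical_if_traces_subset:
  assumes V: "graded_right_ideal \<Gamma> R A V" and sub: "\<And>e. e \<in> Obj \<Gamma> \<Longrightarrow> V \<inter> A e \<subseteq> gr_radical \<Gamma> R A"
  shows "V \<subseteq> gr_radical \<Gamma> R A"
proof -
  have "V \<subseteq> M" if M: "gr_maximal \<Gamma> R A M" for M
  proof (rule gr_maximal_is_extension[OF M])
    fix e assume e: "e \<in> Obj \<Gamma>" "maximal_right_ideal (M \<inter> A e) (component_ring R A e)"
      "M = extension e (M \<inter> A e)"
    have "V \<inter> A e \<subseteq> M \<inter> A e" using sub[OF e(1)] M unfolding gr_radical_def by blast
    then have "V \<subseteq> extension e (M \<inter> A e)"
      using subset_extension_iff[OF e(1) _ V] e(2) unfolding maximal_right_ideal_def by blast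
    then show "V \<subseteq> M" using e(3) by simp
  qed
  then show ?thesis
    using right_idealD(2)[OF graded_right_idealD(1)[OF V]] unfolding gr_radical_def by blast
qed

text \<open>Let \<open>J\<close> be the graded radical. From \<open>R\<close> to \<open>R\<^sub>e\<close>: the trace of a cover of \<open>J\<close> is the trace of \<open>J\<close>
  or a cover of it, so the extension of a right ideal of \<open>R\<^sub>e\<close> that contains all covers downstairs
  contains all covers upstairs. From the \<open>R\<^sub>e\<close> to \<open>R\<close>: each cover \<open>S\<close> of the trace of \<open>J\<close> lies in a
  cover of \<open>J\<close>, namely the graded right ideal generated by \<open>J\<close> and \<open>S\<close>.\<close>

lemma gr_semilocal_iff_components_semilocal:
  "gr_semilocal \<Gamma> R A \<longleftrightarrow> (\<forall>e\<in>Obj \<Gamma>. semilocal_ring (component_ring R A e))"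
proof -
  let ?J = "gr_radical \<Gamma> R A"
  let ?L = "graded_right_ideal \<Gamma> R A"
  let ?Le = "\<lambda>e N. right_ideal N (component_ring R A e)"
  note Jg = gr_radical_graded
  have semilocal: "semilocal_ring (component_ring R A e) \<longleftrightarrow> generated_by_covers (?Le e) (?J \<inter> A e) (A e)"
    if "e \<in> Obj \<Gamma>" for e
    using component_semilocal_iff[OF that] gr_radical_trace[OF that] by simp
  have "generated_by_covers (?Le e) (?J \<inter> A e) (A e)"
    if gen: "generated_by_covers ?L ?J (carrier R)" and e: "e \<in> Obj \<Gamma>" for e
    unfolding generated_by_covers_def
  proof (intro allI impI, elim conjE)
    fix W assume W: "?Le e W" "?J \<inter> A e \<subseteq> W" and cov: "\<forall>U. covers (?Le e) (?J \<inter> A e) U \<longrightarrow> U \<subseteq> W"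
    have "U \<subseteq> extension e W" if U: "covers ?L ?J U" for U
    proof -
      have Ug: "?L U" and JU: "?J \<subseteq> U" and min: "\<And>V. \<lbrakk>?L V; ?J \<subseteq> V; V \<subseteq> U\<rbrakk> \<Longrightarrow> V = ?J \<or> V = U"
        using U unfolding covers_def by auto
      have "U \<inter> A e \<subseteq> W"
      proof (cases "U \<inter> A e = ?J \<inter> A e")
        case True
        then show ?thesis using W(2) by simp
      next
        case False
        have "covers (?Le e) (?J \<inter> A e) (U \<inter> A e)"
          unfolding covers_def
        proof (intro conjI allI impI, goal_cases)
          case 1
          show ?case by (rule trace_right_ideal[OF e graded_right_idealD(1)[OF Ug]])
        next
          case 2
          show ?case using JU by blast
        next
          case 3
          show ?case by (rule False)
        next
          case (4 V)
          then have V: "?Le e V" "?J \<inter> A e \<subseteq> V" "V \<subseteq> U \<inter> A e" by auto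
          \<comment> \<open>A right ideal between the two traces is itself the trace of a graded right ideal between \<open>J\<close> and \<open>U\<close>.\<close>
          let ?X = "carrier R \<inter> \<Inter>{U, extension e V}"
          have "?L ?X"
            by (rule graded_right_ideal_Inter) (use Ug extension_graded[OF e V(1)] in auto)
          moreover have "?J \<subseteq> ?X"
            using JU subset_extension_iff[OF e V(1) Jg] V(2) unfolding extension_def by blast
          moreover have "?X \<inter> A e = V"
            using extension_trace[OF e V(1)] V(3) component(1)[OF Obj_Mor[OF e]] by auto
          ultimately show ?case using min[of ?X] by auto
        qed
        then show ?thesis using cov by blast
      qed
      then show ?thesis using subset_extension_iff[OF e W(1) Ug] by simp
    qed
    moreover have "?J \<subseteq> extension e W" using subset_extension_iff[OF e W(1) Jg] W(2) by simp
    ultimately have "extension e W = carrier R"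
      using gen extension_graded[OF e W(1)] unfolding generated_by_covers_def by blast
    then show "W = A e" using extension_eq_carrier_iff[OF e W(1)] by simp
  qed
  moreover have "generated_by_covers ?L ?J (carrier R)"
    if gen: "\<And>e. e \<in> Obj \<Gamma> \<Longrightarrow> generated_by_covers (?Le e) (?J \<inter> A e) (A e)"
    unfolding generated_by_covers_def
  proof (intro allI impI, elim conjE)
    fix W assume W: "?L W" "?J \<subseteq> W" and cov: "\<forall>U. covers ?L ?J U \<longrightarrow> U \<subseteq> W"
    note Wr = graded_right_idealD(1)[OF W(1)]
    have "A e \<subseteq> W" if e: "e \<in> Obj \<Gamma>" for e
    proof -
      have "S \<subseteq> W \<inter> A e" if S: "covers (?Le e) (?J \<inter> A e) S" for S
      proof -
        have Sr: "?Le e S" and JS: "?J \<inter> A e \<subseteq> S" and ne: "S \<noteq> ?J \<inter> A e"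
          and min: "\<And>V. \<lbrakk>?Le e V; ?J \<inter> A e \<subseteq> V; V \<subseteq> S\<rbrakk> \<Longrightarrow> V = ?J \<inter> A e \<or> V = S"
          using S unfolding covers_def by auto
        have SA: "S \<subseteq> A e" using Sr component_right_ideal_iff[OF e] by blast
        \<comment> \<open>The trace of \<open>U\<close> is \<open>S\<close> at \<open>e\<close> and that of \<open>J\<close> elsewhere, since the corresponding extensions contain \<open>J\<close> and \<open>S\<close>.\<close>
        define U where "U = carrier R \<inter> \<Inter>{V. ?L V \<and> ?J \<subseteq> V \<and> S \<subseteq> V}"
        have Ug: "?L U" unfolding U_def by (rule graded_right_ideal_Inter) auto
        have JU: "?J \<subseteq> U" unfolding U_def gr_radical_def by blast
        have SU: "S \<subseteq> U" unfolding U_def using SA component(1)[OF Obj_Mor[OF e]] by blast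
        have U_least: "U \<subseteq> V" if "?L V" "?J \<subseteq> V" "S \<subseteq> V" for V unfolding U_def using that by blast
        have trace_e: "U \<inter> A e \<subseteq> S"
        proof -
          have "U \<subseteq> extension e S"
            using U_least[OF extension_graded[OF e Sr]] subset_extension_iff[OF e Sr Jg] JS
              extension_trace[OF e Sr] by blast
          then show ?thesis using extension_trace[OF e Sr] by blast
        qed
        have trace_f: "U \<inter> A f \<subseteq> ?J" if f: "f \<in> Obj \<Gamma>" "f \<noteq> e" for f
        proof -
          have Jf: "?Le f (?J \<inter> A f)"
            by (rule trace_right_ideal[OF f(1) graded_right_idealD(1)[OF Jg]])
          have "U \<subseteq> extension f (?J \<inter> A f)"
            using U_least[OF extension_graded[OF f(1) Jf]] subset_extension_iff[OF f(1) Jf Jg] SA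
              extension_other[OF f(1) Jf e] f(2) by blast
          then show ?thesis using extension_trace[OF f(1) Jf] by blast
        qed
        have "covers ?L ?J U"
          unfolding covers_def
        proof (intro conjI allI impI Ug JU)
          show "U \<noteq> ?J" using SU SA ne JS by blast
          fix V assume "?L V \<and> ?J \<subseteq> V \<and> V \<subseteq> U"
          then have V: "?L V" "?J \<subseteq> V" "V \<subseteq> U" by auto
          \<comment> \<open>If the trace at \<open>e\<close> does not grow, none does, and \<open>V\<close> lies in the radical; if it is \<open>S\<close>, then \<open>V\<close> contains the generators of \<open>U\<close>.\<close>
          have "V \<inter> A e = ?J \<inter> A e \<or> V \<inter> A e = S"
            using V trace_e by (intro min trace_right_ideal[OF e graded_right_idealD(1)[OF V(1)]]) auto
          then show "V = ?J \<or> V = U"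
          proof
            assume eq: "V \<inter> A e = ?J \<inter> A e"
            have "V \<subseteq> ?J"
            proof (rule subset_gr_radical_if_traces_subset[OF V(1)])
              show "V \<inter> A f \<subseteq> ?J" if f: "f \<in> Obj \<Gamma>" for f
                using eq trace_f[OF f] V(3) by (cases "f = e") auto
            qed
            then show ?thesis using V(2) by blast
          next
            assume "V \<inter> A e = S"
            then show ?thesis using U_least[OF V(1,2)] V(3) by blast
          qed
        qed
        then show ?thesis using cov SU SA by blast
      qed
      moreover have "?Le e (W \<inter> A e)" by (rule trace_right_ideal[OF e Wr])
      moreover have "?J \<inter> A e \<subseteq> W \<inter> A e" using W(2) by blast
      ultimately have "W \<inter> A e = A e" using gen[OF e] unfolding generated_by_covers_def by blast
      then show ?thesis by blast
    qed
    then show "W = carrier R" by (rule carrier_if_contains_components[OF Wr])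
  qed
  ultimately show ?thesis unfolding gr_semilocal_iff using semilocal by blast
qed

end

theorem proposition6p13:
  fixes \<Gamma> :: "('g, 'm) groupoid_struct_scheme"
    and R :: "('a, 'n) ring_scheme"
    and A :: "'g \<Rightarrow> 'a set"
  assumes "object_unital_graded_ring \<Gamma> R A"
  shows "(gr_semilocal \<Gamma> R A \<longleftrightarrow>
            (\<forall>e\<in>Obj \<Gamma>. gr_semilocal (vertex_group \<Gamma> e) (corner_ring R A e) A)) \<and>
         ((\<forall>e\<in>Obj \<Gamma>. gr_semilocal (vertex_group \<Gamma> e) (corner_ring R A e) A) \<longleftrightarrow>
            (\<forall>e\<in>Obj \<Gamma>. semilocal_ring (component_ring R A e)))"
proof -
  interpret object_unital_graded_ring \<Gamma> R A by fact
  have "gr_semilocal (vertex_group \<Gamma> e) (corner_ring R A e) A \<longleftrightarrow> semilocal_ring (component_ring R A e)"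
    if e: "e \<in> Obj \<Gamma>" for e
  proof -
    have "Obj (vertex_group \<Gamma> e) = {e}" by (simp add: vertex_group_def)
    then show ?thesis
      using object_unital_graded_ring.gr_semilocal_iff_components_semilocal[OF corner_ring_graded[OF e]]
      by (simp add: component_ring_corner_ring)
  qed
  then show ?thesis using gr_semilocal_iff_components_semilocal by simp
qed

end
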